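(* There is an absolute constant $C>0$ such that, for every $m,n\in\mathbb N$, every $p\in[2m,\infty]$, and every complex $m$-homogeneous polynomial $P:\mathbb C^n\to\mathbb C$, \[ \Lambda_{m,q_{m,p}}(P)\le\Bigl(1+\frac Cm\Bigr)\|P\|_p . \]
   Context: For a complex $m$-homogeneous polynomial $P(z)=\sum_{|\alpha|=m}b_\alpha z^\alpha$ on $\mathbb C^n$ ($\alpha\in\mathbb N_0^n$, $|\alpha|=\sum_j\alpha_j$, $\alpha!=\prod_j\alpha_j!$) and $q\ge1$, the Bombieri $q$-norm is \[ \Lambda_{m,q}(P)=\Bigl(\sum_{|\alpha|=m}\Bigl(\frac{m!}{\alpha!}\Bigr)^{1-q}|b_\alpha|^q\Bigr)^{1/q}. \] For $2m\le p<\infty$, $q_{m,p}=\dfrac{2mp}{mp+p-2m}$, and $q_{m,\infty}=\dfrac{2m}{m+1}$. For $1\le p\le\infty$, $\|P\|_p=\sup\{|P(z)|:z\in\mathbb C^n,\ \|z\|_p\le1\}$ with $\|z\|_p$ the $\ell_p^n$ norm. "Absolute constant" means independent of $m,n,p,P$. *)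

theory Defs
  imports "HOL-Analysis.Analysis"
begin

text \<open>
  The dimension \<open>n\<close> is quantified inside the statement, so vectors of \<open>\<complex>\<^sup>n\<close> are functions
  \<open>nat \<Rightarrow> complex\<close> of which only the values at the indices \<open>i < n\<close> are ever used. Multi-indices
  are functions \<open>nat \<Rightarrow> nat\<close> that vanish outside \<open>{..<n}\<close>, so that each one is counted once.
  An \<open>m\<close>-homogeneous polynomial is given by its coefficient family \<open>b\<close>, of which only the values
  on \<open>multi_indices m n\<close> are used.
\<close>

definition multi_indices :: "nat \<Rightarrow> nat \<Rightarrow> (nat \<Rightarrow> nat) set" where
  "multi_indices m n = {\<alpha>. (\<forall>i\<ge>n. \<alpha> i = 0) \<and> (\<Sum>i<n. \<alpha> i) = m}"

definition multi_fact :: "nat \<Rightarrow> (nat \<Rightarrow> nat) \<Rightarrow> real" where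
  "multi_fact n \<alpha> = (\<Prod>i<n. fact (\<alpha> i))"

definition hom_poly ::
    "nat \<Rightarrow> nat \<Rightarrow> ((nat \<Rightarrow> nat) \<Rightarrow> complex) \<Rightarrow> (nat \<Rightarrow> complex) \<Rightarrow> complex" where
  "hom_poly m n b z = (\<Sum>\<alpha>\<in>multi_indices m n. b \<alpha> * (\<Prod>i<n. z i ^ \<alpha> i))"

definition bombieri_norm ::
    "nat \<Rightarrow> nat \<Rightarrow> real \<Rightarrow> ((nat \<Rightarrow> nat) \<Rightarrow> complex) \<Rightarrow> real" where
  "bombieri_norm m n q b =
     (\<Sum>\<alpha>\<in>multi_indices m n.
        (fact m / multi_fact n \<alpha>) powr (1 - q) * cmod (b \<alpha>) powr q) powr (1 / q)"

text \<open>Intended for \<open>n \<ge> 1\<close> and \<open>1 \<le> p \<le> \<infinity>\<close>.\<close>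

definition lp_norm :: "nat \<Rightarrow> ereal \<Rightarrow> (nat \<Rightarrow> complex) \<Rightarrow> real" where
  "lp_norm n p z =
     (if p = \<infinity> then Max ((\<lambda>i. cmod (z i)) ` {..<n})
      else (\<Sum>i<n. cmod (z i) powr real_of_ereal p) powr (1 / real_of_ereal p))"

text \<open>
  The supremum is taken in the reals; lemma \<open>bdd_above_hom_poly\<close> below shows that it is a genuine
  one for homogeneous polynomials.
\<close>

definition lp_sup_norm :: "nat \<Rightarrow> ereal \<Rightarrow> ((nat \<Rightarrow> complex) \<Rightarrow> complex) \<Rightarrow> real" where
  "lp_sup_norm n p f = (SUP z\<in>{z. lp_norm n p z \<le> 1}. cmod (f z))"

definition q_exponent :: "nat \<Rightarrow> ereal \<Rightarrow> real" where
  "q_exponent m p =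
     (if p = \<infinity> then 2 * real m / (real m + 1)
      else 2 * real m * real_of_ereal p / (real m * real_of_ereal p + real_of_ereal p - 2 * real m))"

lemma finite_multi_indices: "finite (multi_indices m n)"
proof -
  have "multi_indices m n \<subseteq> {\<alpha>. \<forall>i. (i \<in> {..<n} \<longrightarrow> \<alpha> i \<in> {..m}) \<and> (i \<notin> {..<n} \<longrightarrow> \<alpha> i = 0)}"
  proof
    fix \<alpha> assume "\<alpha> \<in> multi_indices m n"
    then have 1: "\<forall>i\<ge>n. \<alpha> i = 0" and 2: "(\<Sum>i<n. \<alpha> i) = m"
      by (auto simp: multi_indices_def)
    have "\<alpha> i \<le> m" if "i < n" for i
      using member_le_sum[of i "{..<n}" \<alpha>] that 2 by simp
    with 1 show "\<alpha> \<in> {\<alpha>. \<forall>i. (i \<in> {..<n} \<longrightarrow> \<alpha> i \<in> {..m}) \<and> (i \<notin> {..<n} \<longrightarrow> \<alpha> i = 0)}"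
      by auto
  qed
  moreover have "finite {\<alpha>. \<forall>i. (i \<in> {..<n} \<longrightarrow> \<alpha> i \<in> {..m}) \<and> (i \<notin> {..<n} \<longrightarrow> \<alpha> i = (0::nat))}"
    by (rule finite_set_of_finite_funs) auto
  ultimately show ?thesis by (rule finite_subset)
qed

lemma cmod_le_1_of_lp_norm:
  assumes "1 \<le> p" "lp_norm n p z \<le> 1" "i < n"
  shows "cmod (z i) \<le> 1"
proof (cases "p = \<infinity>")
  case True
  have "cmod (z i) \<le> Max ((\<lambda>i. cmod (z i)) ` {..<n})"
    using assms(3) by (intro Max_ge) auto
  with True assms(2) show ?thesis by (simp add: lp_norm_def)
next
  case False
  with assms(1) obtain r where r: "p = ereal r" "1 \<le> r"
    by (cases p) (auto simp: one_ereal_def)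
  have "cmod (z i) = (cmod (z i) powr r) powr (1 / r)"
    using r by (simp add: powr_powr)
  also have "\<dots> \<le> (\<Sum>i<n. cmod (z i) powr r) powr (1 / r)"
    using r assms(3) by (intro powr_mono2 member_le_sum) auto
  also have "\<dots> \<le> 1"
    using assms(2) r by (simp add: lp_norm_def)
  finally show ?thesis .
qed

lemma bdd_above_hom_poly:
  assumes "1 \<le> p"
  shows "bdd_above ((\<lambda>z. cmod (hom_poly m n b z)) ` {z. lp_norm n p z \<le> 1})"
proof (rule bdd_aboveI2)
  fix z assume "z \<in> {z. lp_norm n p z \<le> 1}"
  then have z: "cmod (z i) \<le> 1" if "i < n" for i
    using cmod_le_1_of_lp_norm[OF assms] that by auto
  have "cmod (b \<alpha> * (\<Prod>i<n. z i ^ \<alpha> i)) \<le> cmod (b \<alpha>)" for \<alpha>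
  proof -
    have "(\<Prod>i<n. cmod (z i) ^ \<alpha> i) \<le> 1"
      using z by (intro prod_le_1) (auto intro: power_le_one)
    then show ?thesis
      by (simp add: norm_mult prod_norm[symmetric] norm_power mult_left_le)
  qed
  then show "cmod (hom_poly m n b z) \<le> (\<Sum>\<alpha>\<in>multi_indices m n. cmod (b \<alpha>))"
    unfolding hom_poly_def by (intro sum_norm_le) auto
qed

end

theory Submission
  imports Defs "HOL-Complex_Analysis.Cauchy_Integral_Formula"
begin

text \<open>
  Write \<open>P\<close> as a symmetric tensor \<open>a\<close>; the Bombieri \<open>q\<close>-norm is the \<open>\<ell>\<^sub>q\<close>-norm of \<open>a\<close>. Pure powers
  \<open>z\<^sub>i\<^sup>m\<close> are isolated by averaging over \<open>m\<close>-th roots of unity, and their \<open>q\<close>-th powers contribute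
  at most \<open>\<parallel>P\<parallel>\<^sub>p\<^sup>q\<close>. For the other monomials, Cauchy's estimate bounds
  \<open>\<Sum>\<^sub>i x\<^sub>i |\<partial>\<^sub>iP(xz)|\<close> by \<open>e m \<parallel>P\<parallel>\<^sub>p\<close> for \<open>\<parallel>x\<parallel>\<^sub>p \<le> 1\<close> and unimodular \<open>z\<close>. Averaging over \<open>z\<close>
  and a contractive one-variable inequality \<open>(\<Sum>\<^sub>j w\<^sub>j |c\<^sub>j|\<^sup>2)\<^sup>1\<^sup>/\<^sup>2 \<le> \<parallel>\<Sum>\<^sub>j c\<^sub>j z\<^sup>j\<parallel>\<^sub>1\<close> with \<open>w\<^sub>0 = 1\<close>,
  tensorised by Minkowski's inequality, give a mixed norm bound on the coefficients. Choosing \<open>x\<close>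
  from the marginals of the distribution \<open>|a|\<^sup>q\<close> and applying Jensen's inequality to the logarithm
  turns this into the \<open>\<ell>\<^sub>q\<close>-bound (this replaces Blei's inequality and covers all \<open>p\<close> at once), with
  an extra factor \<open>O(m\<^sup>-\<^sup>1\<^sup>/\<^sup>2)\<close> because no monomial is pure. Since \<open>q \<ge> 2m / (m + 1)\<close>, the \<open>q\<close>-th
  powers of the non-pure part sum to \<open>O(1 / m) \<parallel>P\<parallel>\<^sub>p\<^sup>q\<close>.
\<close>

subsection \<open>Weighted norms and averages over roots of unity\<close>

definition unit_root :: "nat \<Rightarrow> nat \<Rightarrow> complex" where
  "unit_root N k = cis (2 * pi * real k / real N)"

lemma norm_unit_root [simp]: "cmod (unit_root N k) = 1"
  by (simp add: unit_root_def)

lemma sum_unit_root_power: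
  assumes "N > 0"
  shows "(\<Sum>k<N. unit_root N k ^ a) = (if N dvd a then of_nat N else 0)"
proof -
  define w where "w = cis (2 * pi * real a / real N)"
  have w: "unit_root N k ^ a = w ^ k" for k
    unfolding unit_root_def w_def Complex.DeMoivre by (simp add: mult_ac)
  have w_eq: "w = exp (2 * of_real pi * \<i> * of_nat a / of_nat N)"
    by (simp add: w_def cis_conv_exp mult_ac)
  have w1: "w = 1 \<longleftrightarrow> N dvd a"
    unfolding w_eq using assms by (subst complex_root_unity_eq_1) auto
  have "w ^ N = cis (2 * pi * real a)"
    using assms unfolding w_def Complex.DeMoivre by simp
  then have wN: "w ^ N = 1" by simp
  show ?thesis
  proof (cases "N dvd a")
    case True
    then show ?thesis using w w1 by simp
  next
    case False
    then have "(\<Sum>k<N. w ^ k) = 0"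
      using w1 wN by (simp add: geometric_sum)
    then show ?thesis using w False by simp
  qed
qed

lemma sum_unit_root_orthogonal:
  assumes "a < N" "j < N"
  shows "(\<Sum>k<N. unit_root N k ^ a * cnj (unit_root N k) ^ j) = (if a = j then of_nat N else 0)"
proof -
  have unit: "unit_root N k * cnj (unit_root N k) = 1" for k
    by (simp add: complex_norm_square[symmetric])
  have unit_pow: "unit_root N k ^ i * cnj (unit_root N k) ^ i = 1" for k i
    by (metis unit power_mult_distrib power_one)
  show ?thesis
  proof (cases "j \<le> a")
    case True
    then have "unit_root N k ^ a * cnj (unit_root N k) ^ j = unit_root N k ^ (a - j)" for k
      using unit_pow[of k j]
      by (metis (no_types, lifting) le_add_diff_inverse2 mult.assoc mult.right_neutral power_add)
    then have "(\<Sum>k<N. unit_root N k ^ a * cnj (unit_root N k) ^ j) =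
        (if N dvd (a - j) then of_nat N else 0)"
      using assms sum_unit_root_power[of N "a - j"] by simp
    moreover have "N dvd (a - j) \<longleftrightarrow> a = j"
      using assms True by (auto dest!: dvd_imp_le)
    ultimately show ?thesis by simp
  next
    case False
    then have "unit_root N k ^ a * cnj (unit_root N k) ^ j = cnj (unit_root N k ^ (j - a))" for k
      using unit_pow[of k a] 
      by (metis (no_types, lifting) complex_cnj_power le_add_diff_inverse mult.assoc mult.left_neutral nat_le_linear power_add)
    then have "(\<Sum>k<N. unit_root N k ^ a * cnj (unit_root N k) ^ j) =
        cnj (\<Sum>k<N. unit_root N k ^ (j - a))" by simp
    also have "\<dots> = cnj (if N dvd (j - a) then of_nat N else 0)"
      using assms sum_unit_root_power[of N "j - a"] by simp
    finally show ?thesis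
      using assms False by (auto dest!: dvd_imp_le)
  qed
qed

text \<open>The weight of the constant term must be exactly 1 for the inequality to be contractive
  and tensorise without loss. The other weights telescope to a total below 1/4, which the duality
  argument needs. Their decay is only quadratic, so a monomial loses merely a polynomial factor per
  variable.\<close>

definition wt :: "nat \<Rightarrow> real" where
  "wt j = (if j = 0 then 1 else 1 / (4 * real j * (real j + 1)))"

lemma wt_0 [simp]: "wt 0 = 1" by (simp add: wt_def)

lemma wt_pos [simp]: "wt j > 0" by (simp add: wt_def)

lemma wt_nonneg [simp]: "wt j \<ge> 0" by (simp add: less_imp_le)

lemma wt_neq_0 [simp]: "wt j \<noteq> 0"
  using wt_pos[of j] by linarith

lemma sum_wt: "(\<Sum>j=1..d. wt j) = (1 - 1 / (real d + 1)) / 4"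
proof (induction d)
  case (Suc d)
  have "1 - 1 / x + 1 / (x * (x + 1)) = 1 - 1 / (x + 1)" if "x > 0" for x :: real
    using that by (simp add: divide_simps) (simp add: algebra_simps)
  from this[of "real d + 1"]
  have "1 - 1 / (real d + 1) + 1 / ((real d + 1) * (real d + 2)) = 1 - 1 / (real d + 2)"
    by (simp add: add_ac)
  moreover have "wt (Suc d) = (1 / ((real d + 1) * (real d + 2))) / 4"
    by (simp add: wt_def field_simps)
  moreover have "(\<Sum>j=1..Suc d. wt j) = (\<Sum>j=1..d. wt j) + wt (Suc d)" by simp
  ultimately show ?case
    using Suc by (simp add: add_ac)
qed simp

lemma atMost_eq_insert_0: "{..d} = insert 0 {1..d::nat}"
  by auto

text \<open>
  Duality: the test function below has modulus at most the left-hand side because its two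
  conjugate parts differ by an imaginary number, up to the phase of \<open>c 0\<close>; the part of positive
  frequency does not pair with an analytic polynomial.
\<close>

lemma weighted_l2_le_average:
  fixes c :: "nat \<Rightarrow> complex"
  assumes N: "N > 2 * d"
  shows "sqrt (\<Sum>a\<le>d. wt a * (cmod (c a))\<^sup>2) * real N
    \<le> (\<Sum>k<N. cmod (\<Sum>a\<le>d. c a * unit_root N k ^ a))"
proof -
  define f where "f z = (\<Sum>a\<le>d. c a * z ^ a)" for z
  define Y where "Y = (\<Sum>a\<le>d. wt a * (cmod (c a))\<^sup>2)"
  define V where "V z = (\<Sum>j=1..d. of_real (wt j) * cnj (c j) * cnj z ^ j)" for z
  \<comment> \<open>The default value 1 at \<open>c 0 = 0\<close> keeps \<sigma> unimodular and the
    factorisation of \<open>cnj (c 0)\<close> valid.\<close>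
  define \<sigma> where "\<sigma> = (if c 0 = 0 then 1 else cnj (c 0) / of_real (cmod (c 0)))"
  have \<sigma>: "cmod \<sigma> = 1" "cnj (c 0) = \<sigma> * of_real (cmod (c 0))"
    by (auto simp: \<sigma>_def norm_divide)
  have \<sigma>2: "\<sigma> * cnj \<sigma> = 1" using \<sigma>(1) by (simp add: complex_norm_square[symmetric])
  define h where "h z = cnj (c 0) + V z - \<sigma>\<^sup>2 * cnj (V z)" for z
  have Y: "Y = (cmod (c 0))\<^sup>2 + (\<Sum>j=1..d. wt j * (cmod (c j))\<^sup>2)"
    unfolding Y_def by (subst atMost_eq_insert_0) simp
  have Y0: "Y \<ge> 0" by (auto simp: Y_def intro!: sum_nonneg)
  have h_le: "cmod (h z) \<le> sqrt Y" if z: "cmod z = 1" for z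
  proof -
    have "cmod (V z) \<le> (\<Sum>j=1..d. wt j * cmod (c j))"
      unfolding V_def by (rule sum_norm_le) (simp add: norm_mult norm_power z)
    also have "\<dots> = (\<Sum>j=1..d. sqrt (wt j) * (sqrt (wt j) * cmod (c j)))"
      by (simp flip: mult.assoc)
    finally have "(cmod (V z))\<^sup>2 \<le> (\<Sum>j=1..d. sqrt (wt j) * (sqrt (wt j) * cmod (c j)))\<^sup>2"
      by (intro power_mono) auto
    also have "\<dots> \<le> (\<Sum>j=1..d. (sqrt (wt j))\<^sup>2) * (\<Sum>j=1..d. (sqrt (wt j) * cmod (c j))\<^sup>2)"
      by (rule Cauchy_Schwarz_ineq_sum)
    also have "\<dots> = (\<Sum>j=1..d. wt j) * (\<Sum>j=1..d. wt j * (cmod (c j))\<^sup>2)"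
      by (simp add: power_mult_distrib)
    also have "\<dots> \<le> 1 / 4 * (\<Sum>j=1..d. wt j * (cmod (c j))\<^sup>2)"
      using sum_wt[of d] by (intro mult_right_mono sum_nonneg) auto
    finally have V4: "4 * (cmod (V z))\<^sup>2 \<le> (\<Sum>j=1..d. wt j * (cmod (c j))\<^sup>2)" by simp
    \<comment> \<open>With the phase \<sigma> factored out, the imaginary part of \<open>h z\<close>
      is \<open>2 * Im T\<close>. Its square costs a factor 4, which the bound 1/4 from
      \<open>sum_wt\<close> pays for.\<close>
    define T where "T = cnj \<sigma> * V z"
    have "\<sigma> * (of_real (cmod (c 0)) + (T - cnj T)) =
        \<sigma> * of_real (cmod (c 0)) + (\<sigma> * cnj \<sigma>) * V z - \<sigma>\<^sup>2 * cnj (V z)"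
      unfolding T_def by (simp add: algebra_simps power2_eq_square)
    then have "h z = \<sigma> * (of_real (cmod (c 0)) + (T - cnj T))"
      by (simp add: h_def \<sigma>(2)[symmetric] \<sigma>2)
    also have "of_real (cmod (c 0)) + (T - cnj T) = Complex (cmod (c 0)) (2 * Im T)"
      by (simp add: complex_eq_iff)
    finally have "cmod (h z) = cmod (Complex (cmod (c 0)) (2 * Im T))"
      by (simp add: norm_mult \<sigma>(1))
    then have "(cmod (h z))\<^sup>2 = (cmod (c 0))\<^sup>2 + 4 * (Im T)\<^sup>2"
      by (simp add: cmod_power2 power_mult_distrib)
    also have "(Im T)\<^sup>2 \<le> (cmod T)\<^sup>2"
      by (simp add: abs_Im_le_cmod abs_le_square_iff[symmetric])
    also have "cmod T = cmod (V z)" by (simp add: T_def norm_mult \<sigma>(1))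
    finally have "(cmod (h z))\<^sup>2 \<le> Y" using V4 Y by simp
    then show ?thesis by (rule real_le_rsqrt)
  qed
  have h_eq: "h z = (\<Sum>j\<le>d. of_real (wt j) * cnj (c j) * cnj z ^ j)
      - \<sigma>\<^sup>2 * (\<Sum>j=1..d. of_real (wt j) * c j * z ^ j)" for z
    unfolding h_def V_def by (subst atMost_eq_insert_0) (simp add: algebra_simps)
  let ?z = "unit_root N"
  have fh: "f z * h z =
      (\<Sum>a\<le>d. \<Sum>j\<le>d. c a * (of_real (wt j) * cnj (c j)) * (z ^ a * cnj z ^ j))
     - \<sigma>\<^sup>2 * (\<Sum>a\<le>d. \<Sum>j=1..d. c a * (of_real (wt j) * c j) * z ^ (a + j))" for z
  proof -
    have "f z * h z = f z * (\<Sum>j\<le>d. of_real (wt j) * cnj (c j) * cnj z ^ j)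
      - \<sigma>\<^sup>2 * (f z * (\<Sum>j=1..d. of_real (wt j) * c j * z ^ j))"
      unfolding h_eq by (simp add: algebra_simps)
    then show ?thesis
      unfolding f_def sum_product by (simp add: power_add mult_ac)
  qed
  have "(\<Sum>k<N. f (?z k) * h (?z k)) =
     (\<Sum>k<N. \<Sum>a\<le>d. \<Sum>j\<le>d. c a * (of_real (wt j) * cnj (c j)) * (?z k ^ a * cnj (?z k) ^ j))
     - \<sigma>\<^sup>2 * (\<Sum>k<N. \<Sum>a\<le>d. \<Sum>j=1..d. c a * (of_real (wt j) * c j) * ?z k ^ (a + j))"
    unfolding fh sum_subtractf sum_distrib_left[symmetric] ..
  also have "(\<Sum>k<N. \<Sum>a\<le>d. \<Sum>j\<le>d. c a * (of_real (wt j) * cnj (c j)) * (?z k ^ a * cnj (?z k) ^ j))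
     = (\<Sum>a\<le>d. \<Sum>j\<le>d. c a * (of_real (wt j) * cnj (c j)) * (\<Sum>k<N. ?z k ^ a * cnj (?z k) ^ j))"
    by (subst sum.swap, rule sum.cong[OF refl], subst sum.swap) (simp add: sum_distrib_left)
  also have "\<dots> = (\<Sum>a\<le>d. \<Sum>j\<le>d. if a = j then of_nat N * (of_real (wt a) * (c a * cnj (c a))) else 0)"
    using N by (intro sum.cong refl) (subst sum_unit_root_orthogonal, auto)
  also have "\<dots> = of_nat N * of_real Y"
    by (simp add: Y_def sum_distrib_left complex_norm_square[symmetric])
  also have "(\<Sum>k<N. \<Sum>a\<le>d. \<Sum>j=1..d. c a * (of_real (wt j) * c j) * ?z k ^ (a + j))
     = (\<Sum>a\<le>d. \<Sum>j=1..d. c a * (of_real (wt j) * c j) * (\<Sum>k<N. ?z k ^ (a + j)))"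
    by (subst sum.swap, rule sum.cong[OF refl], subst sum.swap) (simp add: sum_distrib_left)
  also have "\<dots> = 0"
  proof (intro sum.neutral ballI)
    \<comment> \<open>Here \<open>a + j\<close> lies between 1 and \<open>2 * d\<close>, hence
      strictly between 0 and \<open>N\<close>. This is the reason for \<open>N > 2 * d\<close>;
      orthogonality in the first double sum only needs \<open>d < N\<close>.\<close>
    fix a j assume "a \<in> {..d}" "j \<in> {1..d}"
    then have "\<not> N dvd a + j" using N by (auto dest!: dvd_imp_le)
    then show "c a * (of_real (wt j) * c j) * (\<Sum>k<N. ?z k ^ (a + j)) = 0"
      using N by (subst sum_unit_root_power) auto
  qed
  finally have "of_nat N * of_real Y = (\<Sum>k<N. f (?z k) * h (?z k))" by simp
  then have "real N * Y = cmod (\<Sum>k<N. f (?z k) * h (?z k))"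
    using Y0 by (metis abs_of_nonneg mult_nonneg_nonneg norm_of_real of_nat_0_le_iff of_real_mult of_real_of_nat_eq)
  also have "\<dots> \<le> (\<Sum>k<N. cmod (f (?z k)) * sqrt Y)"
    by (intro sum_norm_le) (auto simp: norm_mult intro!: mult_left_mono h_le)
  also have "\<dots> = (\<Sum>k<N. cmod (f (?z k))) * sqrt Y"
    by (simp add: sum_distrib_right)
  finally have *: "real N * Y \<le> (\<Sum>k<N. cmod (f (?z k))) * sqrt Y" .
  show ?thesis
  proof (cases "Y = 0")
    case True
    then show ?thesis by (simp add: Y_def[symmetric] sum_nonneg)
  next
    case False
    then have "sqrt Y > 0" using Y0 by simp
    moreover have "real N * sqrt Y * sqrt Y \<le> (\<Sum>k<N. cmod (f (?z k))) * sqrt Y"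
      using * Y0 by (simp add: mult.assoc)
    ultimately have "real N * sqrt Y \<le> (\<Sum>k<N. cmod (f (?z k)))"
      by (simp add: mult_le_cancel_right)
    then show ?thesis by (simp add: Y_def f_def mult.commute)
  qed
qed

section \<open>Tensorisation over grids of roots of unity\<close>

lemma sum_PiE_insert:
  assumes "j \<notin> J"
  shows "(\<Sum>\<omega>\<in>PiE (insert j J) (\<lambda>_. K). f \<omega>) = (\<Sum>\<omega>\<in>PiE J (\<lambda>_. K). \<Sum>k\<in>K. f (fun_upd \<omega> j k))"
proof -
  have inj: "inj_on (\<lambda>(y, g). fun_upd g j y) (K \<times> PiE J (\<lambda>_. K))"
  proof (rule inj_onI)
    fix u v assume uv: "u \<in> K \<times> PiE J (\<lambda>_. K)" "v \<in> K \<times> PiE J (\<lambda>_. K)"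
      and eq0: "(\<lambda>(y, g). fun_upd g j y) u = (\<lambda>(y, g). fun_upd g j y) v"
    obtain y g where u: "u = (y, g)" by (cases u)
    obtain y' g' where v: "v = (y', g')" by (cases v)
    have g: "g \<in> PiE J (\<lambda>_. K)" "g' \<in> PiE J (\<lambda>_. K)" and eq: "fun_upd g j y = fun_upd g' j y'"
      using uv eq0 unfolding u v by simp_all
    have "y = y'" using fun_cong[OF eq, of j] by simp
    moreover have "g = g'"
    proof
      fix i show "g i = g' i"
        using fun_cong[OF eq, of i] PiE_arb[OF g(1) assms] PiE_arb[OF g(2) assms]
        by (cases "i = j") auto
    qed
    ultimately show "u = v" by (simp add: u v)
  qed
  have "(\<Sum>\<omega>\<in>PiE (insert j J) (\<lambda>_. K). f \<omega>) = (\<Sum>(y, g)\<in>K \<times> PiE J (\<lambda>_. K). f (fun_upd g j y))"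
    unfolding PiE_insert_eq sum.reindex[OF inj] by (simp add: o_def case_prod_unfold)
  also have "\<dots> = (\<Sum>\<omega>\<in>PiE J (\<lambda>_. K). \<Sum>k\<in>K. f (fun_upd \<omega> j k))"
    by (subst sum.cartesian_product[symmetric]) (rule sum.swap)
  finally show ?thesis .
qed

text \<open>Minkowski's inequality for finitely many summands; it moves the sum over the grid of the
  other variables out of the l2 norm in one variable.\<close>

lemma L2_set_sum_le:
  "finite W \<Longrightarrow> L2_set (\<lambda>a. \<Sum>\<omega>\<in>W. f a \<omega>) A \<le> (\<Sum>\<omega>\<in>W. L2_set (\<lambda>a. f a \<omega>) A)"
proof (induction W rule: finite_induct)
  case empty
  then show ?case by (simp add: L2_set_def)
next
  case (insert x W)
  have "L2_set (\<lambda>a. f a x + (\<Sum>\<omega>\<in>W. f a \<omega>)) A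
      \<le> L2_set (\<lambda>a. f a x) A + L2_set (\<lambda>a. \<Sum>\<omega>\<in>W. f a \<omega>) A"
    by (rule L2_set_triangle_ineq)
  then show ?case using insert by simp
qed

text \<open>Induction on \<open>J\<close>: split \<open>S\<close> by the exponent of the new
  variable, apply the induction hypothesis to each slice, interchange norms by Minkowski, and use
  the one-variable inequality at each grid point. The last hypothesis says that the exponents in
  \<open>J\<close> determine the index, so that for empty \<open>J\<close> at most one coefficient
  is left. It allows \<open>J\<close> to omit a variable.\<close>

lemma weighted_l2_le_grid_average:
  fixes c :: "(nat \<Rightarrow> nat) \<Rightarrow> complex"
  assumes "finite J" "finite S" "N > 2 * d" "\<And>\<alpha> j. \<alpha> \<in> S \<Longrightarrow> j \<in> J \<Longrightarrow> \<alpha> j \<le> d"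
    and "\<And>\<alpha> \<beta>. \<alpha> \<in> S \<Longrightarrow> \<beta> \<in> S \<Longrightarrow> (\<And>j. j \<in> J \<Longrightarrow> \<alpha> j = \<beta> j) \<Longrightarrow> \<alpha> = \<beta>"
  shows "sqrt (\<Sum>\<alpha>\<in>S. (\<Prod>j\<in>J. wt (\<alpha> j)) * (cmod (c \<alpha>))\<^sup>2) * real N ^ card J
    \<le> (\<Sum>\<omega>\<in>PiE J (\<lambda>_. {..<N}). cmod (\<Sum>\<alpha>\<in>S. c \<alpha> * (\<Prod>j\<in>J. unit_root N (\<omega> j) ^ \<alpha> j)))"
  using assms(1,2,4,5)
proof (induction J arbitrary: S rule: finite_induct)
  case empty
  show ?case
  proof (cases "S = {}")
    case False
    then obtain \<alpha> where "\<alpha> \<in> S" by blast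
    then have "S = {\<alpha>}" using empty.prems(3) by blast
    then show ?thesis by simp
  qed simp
next
  case (insert j J)
  define Sa where "Sa a = {\<alpha>\<in>S. \<alpha> j = a}" for a
  define C where "C a \<omega> = (\<Sum>\<alpha>\<in>Sa a. c \<alpha> * (\<Prod>i\<in>J. unit_root N (\<omega> i) ^ \<alpha> i))" for a and \<omega> :: "nat \<Rightarrow> nat"
  define Q where "Q a = (\<Sum>\<alpha>\<in>Sa a. (\<Prod>i\<in>J. wt (\<alpha> i)) * (cmod (c \<alpha>))\<^sup>2)" for a
  let ?P = "PiE J (\<lambda>_. {..<N})"
  have finP: "finite ?P" using insert by (intro finite_PiE) auto
  have split: "(\<Sum>\<alpha>\<in>S. g \<alpha>) = (\<Sum>a\<le>d. \<Sum>\<alpha>\<in>Sa a. g \<alpha>)" for g :: "_ \<Rightarrow> 'b::comm_monoid_add"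
    unfolding Sa_def using insert.prems by (intro sum.group[symmetric]) auto
  have Q0: "Q a \<ge> 0" for a
    unfolding Q_def by (intro sum_nonneg mult_nonneg_nonneg prod_nonneg) auto
  have IH: "sqrt (Q a) * real N ^ card J \<le> (\<Sum>\<omega>\<in>?P. cmod (C a \<omega>))" for a
    unfolding Q_def C_def
  proof (rule insert.IH)
    show "finite (Sa a)" using insert.prems by (simp add: Sa_def)
    show "\<alpha> i \<le> d" if "\<alpha> \<in> Sa a" "i \<in> J" for \<alpha> i
      using that insert.prems by (auto simp: Sa_def)
    show "\<alpha> = \<beta>" if "\<alpha> \<in> Sa a" "\<beta> \<in> Sa a" "\<And>i. i \<in> J \<Longrightarrow> \<alpha> i = \<beta> i" for \<alpha> \<beta>
      by (rule insert.prems(3)) (use that in \<open>auto simp: Sa_def\<close>)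
  qed
  have "(\<Sum>\<alpha>\<in>S. (\<Prod>i\<in>insert j J. wt (\<alpha> i)) * (cmod (c \<alpha>))\<^sup>2) = (\<Sum>a\<le>d. wt a * Q a)"
    unfolding split Q_def sum_distrib_left
    using insert.hyps by (intro sum.cong refl) (auto simp: Sa_def)
  then have "sqrt (\<Sum>\<alpha>\<in>S. (\<Prod>i\<in>insert j J. wt (\<alpha> i)) * (cmod (c \<alpha>))\<^sup>2) * real N ^ card J
     = sqrt (\<Sum>a\<le>d. wt a * (Q a * (real N ^ card J)\<^sup>2))"
    by (simp add: real_sqrt_mult sum_distrib_right[symmetric] mult.assoc[symmetric])
  also have "\<dots> = sqrt (\<Sum>a\<le>d. wt a * (sqrt (Q a) * real N ^ card J)\<^sup>2)"
    using Q0 by (simp add: power_mult_distrib)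
  also have "\<dots> \<le> sqrt (\<Sum>a\<le>d. wt a * (\<Sum>\<omega>\<in>?P. cmod (C a \<omega>))\<^sup>2)"
    using IH Q0 by (intro real_sqrt_le_mono sum_mono mult_left_mono power_mono) auto
  also have "\<dots> = L2_set (\<lambda>a. \<Sum>\<omega>\<in>?P. sqrt (wt a) * cmod (C a \<omega>)) {..d}"
    by (simp add: L2_set_def sum_distrib_left[symmetric] power_mult_distrib)
  also have "\<dots> \<le> (\<Sum>\<omega>\<in>?P. L2_set (\<lambda>a. sqrt (wt a) * cmod (C a \<omega>)) {..d})"
    by (rule L2_set_sum_le[OF finP])
  also have "\<dots> = (\<Sum>\<omega>\<in>?P. sqrt (\<Sum>a\<le>d. wt a * (cmod (C a \<omega>))\<^sup>2))"
    by (simp add: L2_set_def power_mult_distrib)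
  finally have "sqrt (\<Sum>\<alpha>\<in>S. (\<Prod>i\<in>insert j J. wt (\<alpha> i)) * (cmod (c \<alpha>))\<^sup>2) * real N ^ card J * real N
     \<le> (\<Sum>\<omega>\<in>?P. sqrt (\<Sum>a\<le>d. wt a * (cmod (C a \<omega>))\<^sup>2)) * real N"
    by (rule mult_right_mono) simp
  also have "\<dots> = (\<Sum>\<omega>\<in>?P. sqrt (\<Sum>a\<le>d. wt a * (cmod (C a \<omega>))\<^sup>2) * real N)"
    by (rule sum_distrib_right)
  also have "\<dots> \<le> (\<Sum>\<omega>\<in>?P. \<Sum>k<N. cmod (\<Sum>a\<le>d. C a \<omega> * unit_root N k ^ a))"
    using assms(3) by (intro sum_mono weighted_l2_le_average)
  also have "\<dots> = (\<Sum>\<omega>\<in>PiE (insert j J) (\<lambda>_. {..<N}).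
      cmod (\<Sum>\<alpha>\<in>S. c \<alpha> * (\<Prod>i\<in>insert j J. unit_root N (\<omega> i) ^ \<alpha> i)))"
    unfolding sum_PiE_insert[OF insert.hyps(2)]
  proof (intro sum.cong refl arg_cong[of _ _ cmod])
    fix \<omega> k
    have "(\<Prod>i\<in>J. unit_root N (fun_upd \<omega> j k i) ^ \<alpha> i) = (\<Prod>i\<in>J. unit_root N (\<omega> i) ^ \<alpha> i)" for \<alpha>
      using insert.hyps by (intro prod.cong) auto
    then show "(\<Sum>a\<le>d. C a \<omega> * unit_root N k ^ a) =
      (\<Sum>\<alpha>\<in>S. c \<alpha> * (\<Prod>i\<in>insert j J. unit_root N (fun_upd \<omega> j k i) ^ \<alpha> i))"
      unfolding split C_def sum_distrib_right
      using insert.hyps by (intro sum.cong refl) (auto simp: Sa_def mult_ac)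
  qed
  finally show ?case using insert.hyps by (simp add: mult_ac)
qed

subsection \<open>Norm bounds for gradients and pure powers\<close>

lemma has_field_derivative_prod_affine_power:
  fixes u :: "nat \<Rightarrow> complex"
  assumes "finite A"
  shows "((\<lambda>l. \<Prod>i\<in>A. (1 + l * u i) ^ \<alpha> i) has_field_derivative (\<Sum>i\<in>A. of_nat (\<alpha> i) * u i)) (at 0)"
  using assms
proof (induction A rule: finite_induct)
  case (insert x A)
  have "((\<lambda>l. (1 + l * u x) ^ \<alpha> x) has_field_derivative of_nat (\<alpha> x) * u x) (at 0)"
    by (auto intro!: derivative_eq_intros)
  from DERIV_mult[OF this insert.IH] insert.hyps show ?case
    by (simp add: add_ac)
qed auto

text \<open>The inner sums are \<open>y i\<close> times the partial derivatives of P at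
  \<open>y\<close>. Factors \<open>w i\<close> align their phases, so that the left side divided by
  \<open>m\<close> becomes the derivative at 0 of P along a complex line through \<open>y\<close>,
  and Cauchy's estimate on the unit disc applies.\<close>

lemma sum_cmod_gradient_le:
  assumes m: "m \<ge> 1"
    and bd: "\<And>y'. (\<And>i. i < n \<Longrightarrow> cmod (y' i) \<le> (1 + 1 / real m) * cmod (y i)) \<Longrightarrow>
      cmod (hom_poly m n b y') \<le> K"
  shows "(\<Sum>i<n. cmod (\<Sum>\<alpha>\<in>multi_indices m n. of_nat (\<alpha> i) * b \<alpha> * (\<Prod>j<n. y j ^ \<alpha> j)))
    \<le> real m * K"
proof -
  define g where "g i = (\<Sum>\<alpha>\<in>multi_indices m n. of_nat (\<alpha> i) * b \<alpha> * (\<Prod>j<n. y j ^ \<alpha> j))" for i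
  define w where "w i = (if g i = 0 then 0 else cnj (g i) / of_real (cmod (g i)))" for i
  have w: "cmod (w i) \<le> 1" "w i * g i = of_real (cmod (g i))" for i
    by (auto simp: w_def norm_divide field_simps complex_norm_square[symmetric] power2_eq_square)
  \<comment> \<open>Dividing by \<open>m\<close> lets each coordinate grow only by the factor
    \<open>1 + 1 / m\<close> on the unit disc. By homogeneity this costs
    \<open>(1 + 1 / m) ^ m\<close>, which is at most e.\<close>
  define \<phi> where "\<phi> l = hom_poly m n b (\<lambda>i. y i * (1 + l * (w i / of_nat m)))" for l
  have \<phi>_eq: "\<phi> = (\<lambda>l. \<Sum>\<alpha>\<in>multi_indices m n.
      (b \<alpha> * (\<Prod>j<n. y j ^ \<alpha> j)) * (\<Prod>i<n. (1 + l * (w i / of_nat m)) ^ \<alpha> i))"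
    by (simp add: \<phi>_def hom_poly_def power_mult_distrib prod.distrib mult_ac fun_eq_iff)
  have "(\<phi> has_field_derivative (\<Sum>\<alpha>\<in>multi_indices m n.
      (b \<alpha> * (\<Prod>j<n. y j ^ \<alpha> j)) * (\<Sum>i<n. of_nat (\<alpha> i) * (w i / of_nat m)))) (at 0)"
    unfolding \<phi>_eq
    by (intro DERIV_sum DERIV_cmult has_field_derivative_prod_affine_power) auto
  also have "(\<Sum>\<alpha>\<in>multi_indices m n.
      (b \<alpha> * (\<Prod>j<n. y j ^ \<alpha> j)) * (\<Sum>i<n. of_nat (\<alpha> i) * (w i / of_nat m))) =
      (\<Sum>i<n. w i * g i) / of_nat m"
    unfolding g_def sum_distrib_left sum_divide_distrib
    by (subst sum.swap) (simp add: mult_ac)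
  also have "\<dots> = of_real ((\<Sum>i<n. cmod (g i)) / real m)"
    using w(2) by simp
  finally have deriv: "deriv \<phi> 0 = of_real ((\<Sum>i<n. cmod (g i)) / real m)"
    by (rule DERIV_imp_deriv)
  have hol: "\<phi> holomorphic_on UNIV"
    unfolding \<phi>_eq by (intro holomorphic_intros)
  have "cmod ((deriv ^^ 1) \<phi> 0) \<le> fact 1 * K / 1 ^ 1"
  proof (rule Cauchy_inequality)
    show "\<phi> holomorphic_on ball 0 1" using hol by (rule holomorphic_on_subset) auto
    show "continuous_on (cball 0 1) \<phi>"
      using hol by (meson holomorphic_on_imp_continuous_on holomorphic_on_subset subset_UNIV)
    fix l :: complex assume l: "cmod (0 - l) = 1"
    show "cmod (\<phi> l) \<le> K"
      unfolding \<phi>_def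
    proof (rule bd)
      fix i
      have "cmod (1 + l * (w i / of_nat m)) \<le> 1 + cmod (l * (w i / of_nat m))"
        by (rule norm_triangle_le) simp
      also have "cmod (l * (w i / of_nat m)) \<le> 1 / real m"
        using l w(1)[of i] m by (simp add: norm_mult norm_divide divide_right_mono)
      finally show "cmod (y i * (1 + l * (w i / of_nat m))) \<le> (1 + 1 / real m) * cmod (y i)"
        by (simp add: norm_mult mult.commute mult_left_mono)
    qed
  qed auto
  then have "cmod (deriv \<phi> 0) \<le> K" by simp
  then have "(\<Sum>i<n. cmod (g i)) / real m \<le> K"
    unfolding deriv norm_of_real by linarith
  then show ?thesis using m by (simp add: g_def field_simps)
qed

section \<open>Homogeneity and test points in the unit ball\<close>

lemma lp_norm_mono:
  assumes "1 \<le> p" "n \<ge> 1" "\<And>i. i < n \<Longrightarrow> cmod (z i) \<le> cmod (x i)"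
  shows "lp_norm n p z \<le> lp_norm n p x"
proof (cases "p = \<infinity>")
  case True
  have "cmod (z i) \<le> Max ((\<lambda>i. cmod (x i)) ` {..<n})" if "i < n" for i
    using assms(3)[OF that] that by (intro order_trans[OF assms(3)[OF that]] Max_ge) auto
  then show ?thesis using True assms(2) by (simp add: lp_norm_def lessThan_empty_iff)
next
  case False
  with assms(1) obtain r where "p = ereal r" "1 \<le> r"
    by (cases p) (auto simp: one_ereal_def)
  then show ?thesis using assms(3)
    by (auto simp: lp_norm_def intro!: powr_mono2 sum_mono sum_nonneg)
qed

lemma hom_poly_scale: "hom_poly m n b (\<lambda>i. c * z i) = c ^ m * hom_poly m n b z"
proof -
  have "(\<Prod>i<n. c ^ \<alpha> i) = c ^ m" if "\<alpha> \<in> multi_indices m n" for \<alpha>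
    using that by (simp add: multi_indices_def power_sum[symmetric])
  then show ?thesis
    unfolding hom_poly_def sum_distrib_left
    by (intro sum.cong refl) (simp add: power_mult_distrib prod.distrib mult_ac)
qed

lemma cmod_hom_poly_le:
  assumes p: "1 \<le> p" "n \<ge> 1" and x: "lp_norm n p x \<le> 1" and R: "R > 0"
    and y: "\<And>i. i < n \<Longrightarrow> cmod (y i) \<le> R * cmod (x i)"
  shows "cmod (hom_poly m n b y) \<le> R ^ m * lp_sup_norm n p (hom_poly m n b)"
proof -
  define z where "z i = y i / of_real R" for i
  have "cmod (z i) \<le> cmod (x i)" if "i < n" for i
    using y[OF that] R by (simp add: z_def norm_divide field_simps)
  then have "lp_norm n p z \<le> 1"
    using lp_norm_mono[OF p, of z x] x by (meson order_trans)
  then have "cmod (hom_poly m n b z) \<le> lp_sup_norm n p (hom_poly m n b)"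
    unfolding lp_sup_norm_def using bdd_above_hom_poly[OF p(1)] by (intro cSUP_upper) auto
  moreover have "y = (\<lambda>i. of_real R * z i)"
    using R by (simp add: z_def)
  then have "hom_poly m n b y = of_real R ^ m * hom_poly m n b z"
    by (metis hom_poly_scale)
  ultimately show ?thesis
    using R by (simp add: norm_mult norm_power)
qed

text \<open>The reciprocal of \<open>p\<close>, with value 0 at infinity. The coefficient estimates
  see \<open>p\<close> only through this number \<theta>, so finite and infinite \<open>p\<close>
  are handled together.\<close>

definition inv_exponent :: "ereal \<Rightarrow> real" where
  "inv_exponent p = (if p = \<infinity> then 0 else 1 / real_of_ereal p)"

text \<open>Probability vectors raised to the power \<open>1 / p\<close> are the points of the unit
  ball at which P is tested.\<close>

lemma lp_norm_powr_inv_exponent_le: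
  assumes "1 \<le> p" "n \<ge> 1" "\<And>i. i < n \<Longrightarrow> \<mu> i \<ge> 0" "(\<Sum>i<n. \<mu> i) \<le> 1"
  shows "lp_norm n p (\<lambda>i. of_real (\<mu> i powr inv_exponent p)) \<le> 1"
proof (cases "p = \<infinity>")
  case True
  \<comment> \<open>For exponent 0 the coordinates are 0 or 1, because
    \<open>0 powr 0 = 0\<close>.\<close>
  moreover have "Max ((\<lambda>i. cmod (of_real (\<mu> i powr 0))) ` {..<n}) \<le> 1"
  proof (rule Max.boundedI)
    show "(\<lambda>i. cmod (of_real (\<mu> i powr 0))) ` {..<n} \<noteq> {}"
      using assms(2) by (simp only: image_is_empty lessThan_empty_iff)
  qed auto
  ultimately show ?thesis by (simp only: lp_norm_def inv_exponent_def simp_thms if_True)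
next
  case False
  with assms(1) obtain r where r: "p = ereal r" "1 \<le> r"
    by (cases p) (auto simp: one_ereal_def)
  have "(\<Sum>i<n. (\<mu> i powr (1 / r)) powr r) = (\<Sum>i<n. \<mu> i)"
    using r assms(3) by (intro sum.cong refl) (simp add: powr_powr)
  moreover have "(\<Sum>i<n. \<mu> i) powr (1 / r) \<le> 1 powr (1 / r)"
    using assms(3,4) r by (intro powr_mono2 sum_nonneg) auto
  ultimately show ?thesis using r by (simp add: lp_norm_def inv_exponent_def)
qed

lemma multi_indices_le:
  assumes "\<alpha> \<in> multi_indices m n"
  shows "\<alpha> j \<le> m"
proof (cases "j < n")
  case True
  then have "\<alpha> j \<le> (\<Sum>i<n. \<alpha> i)" by (intro member_le_sum) auto
  with assms show ?thesis by (simp add: multi_indices_def)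
next
  case False
  with assms show ?thesis by (simp add: multi_indices_def)
qed

text \<open>
  By homogeneity the exponent of the variable \<open>i\<close> is determined by the others, so no weight
  is lost in that variable.
\<close>

lemma sum_sqrt_gradient_le:
  fixes x :: "nat \<Rightarrow> real"
  assumes m: "m \<ge> 1" and x: "\<And>i. x i \<ge> 0"
    and bd: "\<And>y. (\<And>i. i < n \<Longrightarrow> cmod (y i) \<le> (1 + 1 / real m) * x i) \<Longrightarrow>
      cmod (hom_poly m n b y) \<le> K"
  shows "(\<Sum>i<n. sqrt (\<Sum>\<alpha>\<in>multi_indices m n. (\<Prod>j\<in>{..<n} - {i}. wt (\<alpha> j)) *
      (real (\<alpha> i) * cmod (b \<alpha>) * (\<Prod>j<n. x j ^ \<alpha> j))\<^sup>2)) \<le> real m * K"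
proof -
  \<comment> \<open>The least \<open>N\<close> that the one-variable inequality admits for exponents
    up to \<open>m\<close>.\<close>
  define N where "N = 2 * m + 1"
  define y where "y \<omega> j = of_real (x j) * unit_root N (\<omega> j)" for \<omega> :: "nat \<Rightarrow> nat" and j
  define g where "g i z = (\<Sum>\<alpha>\<in>multi_indices m n. of_nat (\<alpha> i) * b \<alpha> * (\<Prod>j<n. z j ^ \<alpha> j))"
    for i and z :: "nat \<Rightarrow> complex"
  define Q where "Q i = sqrt (\<Sum>\<alpha>\<in>multi_indices m n. (\<Prod>j\<in>{..<n} - {i}. wt (\<alpha> j)) *
      (real (\<alpha> i) * cmod (b \<alpha>) * (\<Prod>j<n. x j ^ \<alpha> j))\<^sup>2)" for i
  let ?P = "\<lambda>J. PiE J (\<lambda>_::nat. {..<N})"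
  have upper: "(\<Sum>i<n. cmod (g i (y \<omega>))) \<le> real m * K" for \<omega>
    unfolding g_def
  proof (rule sum_cmod_gradient_le[OF m])
    fix y' assume "\<And>i. i < n \<Longrightarrow> cmod (y' i) \<le> (1 + 1 / real m) * cmod (y \<omega> i)"
    then show "cmod (hom_poly m n b y') \<le> K"
      using x by (intro bd) (auto simp: y_def norm_mult)
  qed
  have lower: "Q i * real N ^ n \<le> (\<Sum>\<omega>\<in>?P {..<n}. cmod (g i (y \<omega>)))" if i: "i < n" for i
  proof -
    define J where "J = {..<n} - {i}"
    have J: "{..<n} = insert i J" "i \<notin> J" "finite J" "card J = n - 1"
      using i by (auto simp: J_def)
    \<comment> \<open>The variable \<open>i\<close> is frozen at a root of unity and its power
      absorbed into the coefficient. The modulus of \<open>c k \<alpha>\<close> does not depend on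
      \<open>k\<close>, so the same \<open>Q i\<close> bounds the average from below for every
      \<open>k\<close>.\<close>
    define c where "c k \<alpha> = of_nat (\<alpha> i) * b \<alpha> * (\<Prod>j<n. of_real (x j) ^ \<alpha> j) * unit_root N k ^ \<alpha> i"
      for k \<alpha>
    have eq: "g i (y (fun_upd \<omega> i k)) =
        (\<Sum>\<alpha>\<in>multi_indices m n. c k \<alpha> * (\<Prod>j\<in>J. unit_root N (\<omega> j) ^ \<alpha> j))" for \<omega> k
    proof -
      have "(\<Prod>j\<in>J. unit_root N (fun_upd \<omega> i k j) ^ \<alpha> j) = (\<Prod>j\<in>J. unit_root N (\<omega> j) ^ \<alpha> j)" for \<alpha>
        using J by (intro prod.cong) auto
      then have "(\<Prod>j<n. unit_root N (fun_upd \<omega> i k j) ^ \<alpha> j)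
          = unit_root N k ^ \<alpha> i * (\<Prod>j\<in>J. unit_root N (\<omega> j) ^ \<alpha> j)" for \<alpha>
        unfolding J(1) using J by simp
      then show ?thesis
        unfolding g_def c_def y_def by (simp add: power_mult_distrib prod.distrib mult_ac)
    qed
    have Q_eq: "Q i = sqrt (\<Sum>\<alpha>\<in>multi_indices m n. (\<Prod>j\<in>J. wt (\<alpha> j)) * (cmod (c k \<alpha>))\<^sup>2)" for k
    proof -
      have "cmod (c k \<alpha>) = real (\<alpha> i) * cmod (b \<alpha>) * (\<Prod>j<n. x j ^ \<alpha> j)" for \<alpha>
        using x by (simp add: c_def norm_mult norm_power prod_norm[symmetric])
      then show ?thesis by (simp add: Q_def J_def)
    qed
    have step: "Q i * real N ^ card J \<le>
        (\<Sum>\<omega>\<in>?P J. cmod (\<Sum>\<alpha>\<in>multi_indices m n. c k \<alpha> * (\<Prod>j\<in>J. unit_root N (\<omega> j) ^ \<alpha> j)))" for k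
      unfolding Q_eq[of k]
    proof (rule weighted_l2_le_grid_average)
      show "finite J" by (fact J(3))
      show "finite (multi_indices m n)" by (rule finite_multi_indices)
      show "2 * m < N" by (simp add: N_def)
      show "\<alpha> j \<le> m" if "\<alpha> \<in> multi_indices m n" for \<alpha> j
        using that by (rule multi_indices_le)
      fix \<alpha> \<beta> assume ab: "\<alpha> \<in> multi_indices m n" "\<beta> \<in> multi_indices m n"
        and agree: "\<And>j. j \<in> J \<Longrightarrow> \<alpha> j = \<beta> j"
      have "\<alpha> i + sum \<alpha> J = m" "\<beta> i + sum \<beta> J = m"
        using ab J by (simp_all add: multi_indices_def)
      moreover have "sum \<alpha> J = sum \<beta> J" using agree by (rule sum.cong[OF refl])
      ultimately have "\<alpha> i = \<beta> i" by simp
      show "\<alpha> = \<beta>"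
      proof
        fix j
        show "\<alpha> j = \<beta> j"
        proof (cases "j < n")
          case True
          then show ?thesis using \<open>\<alpha> i = \<beta> i\<close> agree by (cases "j = i") (auto simp: J_def)
        next
          case False
          then show ?thesis using ab by (simp add: multi_indices_def)
        qed
      qed
    qed
    have "Q i * real N ^ n = (\<Sum>k<N. Q i * real N ^ card J)"
      using i by (cases n) (simp_all add: J(4))
    also have "\<dots> \<le> (\<Sum>k<N. \<Sum>\<omega>\<in>?P J. cmod (g i (y (fun_upd \<omega> i k))))"
      unfolding eq using step by (intro sum_mono)
    also have "\<dots> = (\<Sum>\<omega>\<in>?P {..<n}. cmod (g i (y \<omega>)))"
      unfolding J(1) sum_PiE_insert[OF J(2)] by (rule sum.swap)
    finally show ?thesis .
  qed
  have "(\<Sum>i<n. Q i) * real N ^ n \<le> (\<Sum>i<n. \<Sum>\<omega>\<in>?P {..<n}. cmod (g i (y \<omega>)))"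
    unfolding sum_distrib_right using lower by (intro sum_mono) auto
  also have "\<dots> = (\<Sum>\<omega>\<in>?P {..<n}. \<Sum>i<n. cmod (g i (y \<omega>)))"
    by (rule sum.swap)
  also have "\<dots> \<le> (\<Sum>\<omega>\<in>?P {..<n}. real m * K)"
    by (intro sum_mono upper)
  also have "\<dots> = real m * K * real N ^ n"
    by (simp add: card_PiE)
  finally have "(\<Sum>i<n. Q i) \<le> real m * K"
    by (rule mult_right_le_imp_le) (simp add: N_def)
  then show ?thesis by (simp add: Q_def)
qed

section \<open>Coefficients of the pure powers\<close>

definition diag_index :: "nat \<Rightarrow> nat \<Rightarrow> nat \<Rightarrow> nat" where
  "diag_index m i = (\<lambda>j. if j = i then m else 0)"

lemma diag_index_in: "i < n \<Longrightarrow> diag_index m i \<in> multi_indices m n"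
  by (simp add: diag_index_def multi_indices_def)

lemma inj_on_diag_index: "m \<ge> 1 \<Longrightarrow> inj_on (diag_index m) A"
  by (rule inj_onI) (metis diag_index_def not_one_le_zero)

lemma multi_indices_eq_diag:
  assumes "\<alpha> \<in> multi_indices m n" "\<alpha> i = m" "i < n"
  shows "\<alpha> = diag_index m i"
proof
  fix j
  have "(\<Sum>i<n. \<alpha> i) = \<alpha> i + (\<Sum>i\<in>{..<n} - {i}. \<alpha> i)"
    using assms(3) by (simp add: sum.remove)
  then have "(\<Sum>i\<in>{..<n} - {i}. \<alpha> i) = 0"
    using assms by (simp add: multi_indices_def)
  then show "\<alpha> j = diag_index m i j"
    using assms by (cases "j < n") (auto simp: diag_index_def multi_indices_def)
qed

text \<open>Rotating each variable by such a number makes the coefficient of its pure power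
  nonnegative, so that no cancellation occurs when these coefficients are added.\<close>

lemma ex_unimodular_root:
  assumes "m \<ge> 1"
  shows "\<exists>\<eta>. cmod \<eta> = 1 \<and> b * \<eta> ^ m = of_real (cmod b)"
proof (cases "b = 0")
  case True
  then show ?thesis by (intro exI[of _ 1]) simp
next
  case False
  define \<eta> where "\<eta> = cis (- Arg b / real m)"
  have "\<eta> ^ m = cis (- Arg b)"
    using assms unfolding \<eta>_def Complex.DeMoivre by simp
  then have "b * \<eta> ^ m = of_real (cmod b) * (cis (Arg b) * cis (- Arg b))"
    using rcis_cmod_Arg[of b] by (metis mult.assoc rcis_def)
  also have "\<dots> = of_real (cmod b)" by (simp add: cis_mult)
  finally show ?thesis by (intro exI[of _ \<eta>]) (simp add: \<eta>_def)
qed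

text \<open>Averaging over \<open>m\<close>-th roots of unity in every variable keeps only the pure powers.\<close>

lemma sum_diag_coeffs_le:
  fixes x :: "nat \<Rightarrow> real"
  assumes m: "m \<ge> 1" and x: "\<And>i. x i \<ge> 0"
    and bd: "\<And>y. (\<And>i. i < n \<Longrightarrow> cmod (y i) \<le> x i) \<Longrightarrow> cmod (hom_poly m n b y) \<le> K"
  shows "(\<Sum>i<n. x i ^ m * cmod (b (diag_index m i))) \<le> K"
proof -
  from ex_unimodular_root[OF m]
  have "\<forall>i. \<exists>\<eta>. cmod \<eta> = 1 \<and> b (diag_index m i) * \<eta> ^ m = of_real (cmod (b (diag_index m i)))"
    by blast
  then obtain \<eta> where \<eta>: "\<And>i. cmod (\<eta> i) = 1"
    "\<And>i. b (diag_index m i) * \<eta> i ^ m = of_real (cmod (b (diag_index m i)))"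
    by metis
  define c where "c \<alpha> = b \<alpha> * (\<Prod>j<n. (of_real (x j) * \<eta> j) ^ \<alpha> j)" for \<alpha>
  define y where "y \<omega> j = of_real (x j) * \<eta> j * unit_root m (\<omega> j)" for \<omega> :: "nat \<Rightarrow> nat" and j
  let ?P = "PiE {..<n} (\<lambda>_::nat. {..<m})"
  have c_diag: "c (diag_index m i) = of_real (x i ^ m * cmod (b (diag_index m i)))" if "i < n" for i
  proof -
    have "(\<Prod>j<n. (of_real (x j) * \<eta> j) ^ diag_index m i j)
        = (\<Prod>j<n. if j = i then (of_real (x i) * \<eta> i) ^ m else 1)"
      by (intro prod.cong) (auto simp: diag_index_def)
    also have "\<dots> = of_real (x i) ^ m * \<eta> i ^ m"
      using that by (simp add: power_mult_distrib)
    finally show ?thesis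
      unfolding c_def using \<eta>(2)[of i] by (metis mult.assoc mult.commute of_real_mult of_real_power)
  qed
  have dvd_diag: "m dvd diag_index m i j" for i j
    by (simp add: diag_index_def)
  have "(\<Sum>\<omega>\<in>?P. hom_poly m n b (y \<omega>)) =
      (\<Sum>\<omega>\<in>?P. \<Sum>\<alpha>\<in>multi_indices m n. c \<alpha> * (\<Prod>j<n. unit_root m (\<omega> j) ^ \<alpha> j))"
    unfolding hom_poly_def y_def c_def by (simp add: power_mult_distrib prod.distrib mult_ac)
  also have "\<dots> = (\<Sum>\<alpha>\<in>multi_indices m n. c \<alpha> * (\<Sum>\<omega>\<in>?P. \<Prod>j<n. unit_root m (\<omega> j) ^ \<alpha> j))"
    by (subst sum.swap) (simp add: sum_distrib_left)
  also have "\<dots> = (\<Sum>\<alpha>\<in>multi_indices m n. c \<alpha> * (\<Prod>j<n. if m dvd \<alpha> j then of_nat m else 0))"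
    using m by (intro sum.cong refl arg_cong2[of _ _ _ _ "(*)"], subst prod_sum_PiE[symmetric])
      (auto intro!: prod.cong simp: sum_unit_root_power)
  also have "\<dots> = (\<Sum>\<alpha>\<in>diag_index m ` {..<n}. c \<alpha> * (\<Prod>j<n. if m dvd \<alpha> j then of_nat m else 0))"
  proof (rule sum.mono_neutral_right)
    show "finite (multi_indices m n)" by (rule finite_multi_indices)
    show "diag_index m ` {..<n} \<subseteq> multi_indices m n" by (auto intro: diag_index_in)
    show "\<forall>\<alpha>\<in>multi_indices m n - diag_index m ` {..<n}.
        c \<alpha> * (\<Prod>j<n. if m dvd \<alpha> j then of_nat m else 0) = 0"
    proof
      fix \<alpha> assume \<alpha>: "\<alpha> \<in> multi_indices m n - diag_index m ` {..<n}"
      have "\<exists>j<n. \<alpha> j \<noteq> 0"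
        by (rule ccontr) (use \<alpha> m in \<open>auto simp: multi_indices_def\<close>)
      then obtain j where j: "j < n" "\<alpha> j \<noteq> 0" by blast
      \<comment> \<open>An index that is not pure has an exponent strictly between 0 and
        \<open>m\<close>, and averaging over that variable already gives zero.\<close>
      have "\<alpha> j \<noteq> m" using \<alpha> j multi_indices_eq_diag[of \<alpha> m n j] by auto
      moreover have "\<alpha> j \<le> m" using \<alpha> multi_indices_le by blast
      ultimately have "\<not> m dvd \<alpha> j" using j by (auto dest!: dvd_imp_le)
      then have "(\<Prod>j<n. if m dvd \<alpha> j then of_nat m else (0::complex)) = 0"
        using j by (auto simp: prod_zero_iff)
      then show "c \<alpha> * (\<Prod>j<n. if m dvd \<alpha> j then of_nat m else 0) = 0" by simp
    qed
  qed
  also have "\<dots> = (\<Sum>i<n. c (diag_index m i) * of_nat m ^ n)"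
    unfolding sum.reindex[OF inj_on_diag_index[OF m]]
    by (simp add: dvd_diag)
  also have "\<dots> = of_real ((\<Sum>i<n. x i ^ m * cmod (b (diag_index m i))) * real m ^ n)"
    unfolding sum_distrib_right of_real_sum
    by (intro sum.cong refl) (simp add: c_diag)
  finally have eq: "(\<Sum>\<omega>\<in>?P. hom_poly m n b (y \<omega>)) =
      of_real ((\<Sum>i<n. x i ^ m * cmod (b (diag_index m i))) * real m ^ n)" .
  have "(\<Sum>i<n. x i ^ m * cmod (b (diag_index m i))) * real m ^ n
      \<le> cmod (\<Sum>\<omega>\<in>?P. hom_poly m n b (y \<omega>))"
    unfolding eq norm_of_real by (rule abs_ge_self)
  also have "\<dots> \<le> (\<Sum>\<omega>\<in>?P. K)"
    using x \<eta>(1) by (intro sum_norm_le bd) (auto simp: y_def norm_mult)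
  also have "\<dots> = K * real m ^ n"
    by (simp add: card_PiE)
  finally show ?thesis
    by (rule mult_right_le_imp_le) (use m in simp)
qed

subsection \<open>Combinatorial estimates\<close>

text \<open>The share of one variable in the denominator once the factorials of a multinomial
  coefficient are combined with the weights; the task is to compare products of these with
  \<open>fact m\<close>.\<close>

definition dfac :: "nat \<Rightarrow> real" where "dfac a = fact a / wt a"

lemma dfac_pos [simp]: "dfac a > 0" by (simp add: dfac_def)

lemma dfac_0 [simp]: "dfac 0 = 1" by (simp add: dfac_def)

lemma dfac_eq: "a \<ge> 1 \<Longrightarrow> dfac a = 4 * real a * (real a + 1) * fact a"
  by (simp add: dfac_def wt_def)

lemma dfac_Suc: "a \<ge> 1 \<Longrightarrow> dfac (Suc a) = dfac a * (real a + 3 + 2 / real a)"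
  by (simp add: dfac_eq divide_simps) (simp add: algebra_simps)

text \<open>The threshold 5 is where the ratio \<open>a + 3 + 2 / a\<close> of consecutive values
  passes \<open>8\<close>, which is the value of \<open>dfac 1\<close>.\<close>

lemma dfac_Suc_ge:
  assumes "a \<ge> 5"
  shows "8 * dfac a \<le> dfac (Suc a)"
proof -
  have "real a \<ge> 5" "2 / real a \<ge> 0" using assms by simp_all
  then have "8 \<le> real a + 3 + 2 / real a" by linarith
  then have "dfac a * 8 \<le> dfac a * (real a + 3 + 2 / real a)"
    by (intro mult_left_mono) (auto simp: less_imp_le)
  then show ?thesis using assms by (simp add: dfac_Suc)
qed

lemma power_8_mult_dfac_le:
  assumes "a \<ge> 5"
  shows "8 ^ s * dfac a \<le> dfac (a + s)"
proof (induction s)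
  case (Suc s)
  have "8 ^ Suc s * dfac a \<le> 8 * dfac (a + s)" using Suc by simp
  also have "\<dots> \<le> dfac (a + Suc s)" using assms dfac_Suc_ge[of "a + s"] by simp
  finally show ?case .
qed simp

text \<open>Passing from 0 to 1 in \<open>a\<close> costs the factor \<open>dfac 1 = 8\<close>,
  covered by \<open>dfac_Suc_ge\<close>. For later steps the ratio of consecutive values at
  \<open>a\<close> is at most the one at \<open>s + a\<close>.\<close>

lemma dfac_mult_le:
  assumes "s \<ge> 5"
  shows "dfac s * dfac a \<le> dfac (s + a)"
proof (induction a)
  case (Suc a)
  show ?case
  proof (cases "a = 0")
    case True
    have "dfac 1 = 8" by (simp add: dfac_eq)
    then show ?thesis using True dfac_Suc_ge[OF assms] by simp
  next
    case False
    have "2 / real a \<le> real s + 2 / real (s + a)"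
    proof -
      have "2 / real a \<le> 2" using False by (simp add: divide_simps)
      also have "\<dots> \<le> real s" using assms by simp
      finally show ?thesis by (simp add: add_increasing2)
    qed
    then have "dfac s * dfac a * (real a + 3 + 2 / real a)
        \<le> dfac (s + a) * (real (s + a) + 3 + 2 / real (s + a))"
      using Suc by (intro mult_mono) (auto simp: less_imp_le)
    then show ?thesis using False by (simp add: dfac_Suc)
  qed
qed simp

lemma dfac_le_power_8: "a \<le> 5 \<Longrightarrow> dfac a \<le> 8 ^ a"
proof -
  assume "a \<le> 5"
  then consider "a = 0" | "a = 1" | "a = 2" | "a = 3" | "a = 4" | "a = 5" by linarith
  then show ?thesis by cases (simp_all add: dfac_eq fact_numeral)
qed

text \<open>The quotient \<open>8 ^ a / dfac a\<close> increases up to \<open>a = 5\<close>, where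
  it is below 3, and decreases afterwards by \<open>dfac_Suc_ge\<close>.\<close>

lemma power_8_le_dfac: "a \<ge> 1 \<Longrightarrow> 8 ^ a \<le> 3 * dfac a"
proof (induction a rule: nat_induct_at_least)
  case base
  show ?case by (simp add: dfac_eq)
next
  case (Suc a)
  show ?case
  proof (cases "a \<ge> 5")
    case True
    show ?thesis using Suc dfac_Suc_ge[OF True] by simp
  next
    case False
    then consider "a = 1" | "a = 2" | "a = 3" | "a = 4" using Suc.hyps by linarith
    then show ?thesis by cases (simp_all add: dfac_eq fact_numeral)
  qed
qed

text \<open>
  \<open>dfac\<close> is supermultiplicative only from \<open>5\<close> on; below that, powers of \<open>8\<close> dominate it.
\<close>

lemma prod_dfac_le:
  assumes "finite J"
  shows "(\<Prod>j\<in>J. dfac (\<alpha> j)) \<le> max (8 ^ (\<Sum>j\<in>J. \<alpha> j)) (dfac (\<Sum>j\<in>J. \<alpha> j))"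
  using assms
proof (induction J rule: finite_induct)
  case (insert i J)
  let ?F = "\<lambda>s. max (8 ^ s) (dfac s)"
  have "?F s * dfac a \<le> ?F (s + a)" for s a
  proof -
    have "8 ^ s * dfac a \<le> ?F (s + a)"
    proof (cases "a \<ge> 5")
      case True
      then show ?thesis
        using power_8_mult_dfac_le[of a s] by (simp add: add.commute le_max_iff_disj)
    next
      case False
      then have "8 ^ s * dfac a \<le> 8 ^ s * 8 ^ a"
        by (intro mult_left_mono dfac_le_power_8) auto
      then show ?thesis by (simp add: power_add le_max_iff_disj)
    qed
    moreover have "dfac s * dfac a \<le> ?F (s + a)"
    proof (cases "s \<ge> 5")
      case True
      then show ?thesis using dfac_mult_le[of s a] by (simp add: le_max_iff_disj)
    next
      case False
      then have "dfac s * dfac a \<le> 8 ^ s * dfac a"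
        by (intro mult_right_mono dfac_le_power_8) (auto simp: less_imp_le)
      with \<open>8 ^ s * dfac a \<le> ?F (s + a)\<close> show ?thesis by (rule order_trans[rotated])
    qed
    moreover have "?F s = 8 ^ s \<or> ?F s = dfac s" by linarith
    ultimately show ?thesis by metis
  qed
  note step = this
  have "(\<Prod>j\<in>insert i J. dfac (\<alpha> j)) = (\<Prod>j\<in>J. dfac (\<alpha> j)) * dfac (\<alpha> i)"
    using insert.hyps by simp
  also have "\<dots> \<le> ?F (\<Sum>j\<in>J. \<alpha> j) * dfac (\<alpha> i)"
    by (rule mult_right_mono[OF insert.IH]) (simp add: less_imp_le)
  also have "\<dots> \<le> ?F ((\<Sum>j\<in>J. \<alpha> j) + \<alpha> i)" by (rule step)
  also have "(\<Sum>j\<in>J. \<alpha> j) + \<alpha> i = (\<Sum>j\<in>insert i J. \<alpha> j)" using insert.hyps by simp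
  finally show ?case .
qed simp

lemma prod_fact_le: "finite J \<Longrightarrow> (\<Prod>j\<in>J. fact (\<alpha> j)) \<le> (fact (\<Sum>j\<in>J. \<alpha> j) :: real)"
proof (induction J rule: finite_induct)
  case (insert i J)
  have "fact (\<alpha> i) * (\<Prod>j\<in>J. fact (\<alpha> j)) \<le> fact (\<alpha> i) * (fact (\<Sum>j\<in>J. \<alpha> j) :: real)"
    using insert.IH by (intro mult_left_mono) auto
  also have "\<dots> = real (fact (\<alpha> i) * fact (\<Sum>j\<in>J. \<alpha> j))" by simp
  also have "\<dots> \<le> real (fact (\<alpha> i + (\<Sum>j\<in>J. \<alpha> j)))"
    by (intro of_nat_mono dvd_imp_le fact_fact_dvd_fact) auto
  finally show ?case using insert.hyps by simp
qed simp

lemma power_div_fact_le_exp: "x \<ge> 0 \<Longrightarrow> x ^ n / fact n \<le> exp (x::real)"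
  using sum_le_suminf[OF summable_exp[of x], of "{n}"]
  by (simp add: exp_def divide_inverse scaleR_conv_of_real mult_ac)

text \<open>Rows of Pascal's triangle are symmetric and unimodal.\<close>

lemma binomial_ge_choose:
  assumes "k \<le> A" "A + k \<le> m"
  shows "m choose A \<ge> m choose k"
proof (cases "2 * A \<le> m")
  case True
  then show ?thesis using assms by (intro binomial_mono) auto
next
  case False
  have "m choose k \<le> m choose (m - A)" using assms False by (intro binomial_mono) auto
  also have "\<dots> = m choose A" using assms by (simp add: binomial_symmetric[symmetric])
  finally show ?thesis .
qed

text \<open>
  \<open>gain m n \<alpha>\<close> is what the monomial \<open>\<alpha>\<close> contributes in the entropy inequality \<open>entropy_bound\<close>:
  the logarithm of \<open>(m - 1)! / (\<alpha> - e\<^sub>i)!\<close> times the weights of the variables other than \<open>i\<close>,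
  averaged over \<open>i\<close> with probabilities \<open>\<alpha> i / m\<close>. It is about \<open>ln m\<close> at worst for
  non-pure monomials and vanishes for pure powers, which are therefore treated separately.
\<close>

definition gain :: "nat \<Rightarrow> nat \<Rightarrow> (nat \<Rightarrow> nat) \<Rightarrow> real" where
  "gain m n \<alpha> = ln (fact m / multi_fact n \<alpha>)
     + (\<Sum>i<n. real (\<alpha> i) / real m *
         (ln (real (\<alpha> i) / real m) + (\<Sum>j\<in>{..<n} - {i}. ln (wt (\<alpha> j)))))"

section \<open>Lower bounds for \<open>gain\<close>\<close>

lemma neg_ln_wt_bounds: "0 \<le> - ln (wt a)" "- ln (wt a) \<le> 3 * real a"
proof -
  have "wt a \<le> 1"
  proof (cases "a = 0")
    case False
    then have "1 * 1 \<le> (4 * real a) * (real a + 1)"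
      by (intro mult_mono) auto
    then show ?thesis using False by (simp add: wt_def)
  qed simp
  then show "0 \<le> - ln (wt a)" by (simp add: ln_le_zero_iff)
  have "1 \<le> wt a * 8 ^ a"
  proof (cases "a = 0")
    case False
    then have "a \<ge> 1" by simp
    then have "4 * real a * (real a + 1) \<le> 8 ^ a"
    proof (induction a rule: nat_induct_at_least)
      case (Suc a)
      have "(4 * (real a + 1)) * (real a + 2) \<le> (4 * (real a + 1)) * (8 * real a)"
        using Suc.hyps by (intro mult_left_mono) auto
      also have "\<dots> = 8 * (4 * real a * (real a + 1))" by (simp only: mult_ac)
      also have "\<dots> \<le> 8 * 8 ^ a" using Suc.IH by simp
      finally show ?case by (simp add: add_ac)
    qed simp
    then show ?thesis using False by (simp add: wt_def)
  qed simp
  then have "ln 1 \<le> ln (wt a * 8 ^ a)" by (subst ln_le_cancel_iff) auto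
  also have "\<dots> = ln (wt a) + real a * ln 8"
    by (simp add: ln_mult_pos ln_realpow)
  finally have "- ln (wt a) \<le> real a * ln 8" by simp
  also have "ln 8 = 3 * ln (2::real)"
    using ln_realpow[of 2 3] by simp
  also have "real a * (3 * ln 2) \<le> real a * 3"
    using ln_2_less_1 by (intro mult_left_mono) auto
  finally show "- ln (wt a) \<le> 3 * real a" by simp
qed

lemma mult_ln_self_ge: "t \<ge> 0 \<Longrightarrow> t * ln t \<ge> - (1::real)"
proof (cases "t = 0")
  case False
  assume "t \<ge> 0"
  with False have t: "t > 0" by simp
  have "ln (1 / t) \<le> 1 / t" using t by (intro ln_bound) simp
  then have "t * ln (1 / t) \<le> t * (1 / t)" using t by (intro mult_left_mono) auto
  then show ?thesis using t by (simp add: ln_div)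
qed simp

lemma sum_ln_wt_ge: "(\<Sum>j\<in>J. ln (wt (\<alpha> j))) \<ge> - 3 * real (\<Sum>j\<in>J. \<alpha> j)"
proof -
  have "(\<Sum>j\<in>J. - 3 * real (\<alpha> j)) \<le> (\<Sum>j\<in>J. ln (wt (\<alpha> j)))"
    using neg_ln_wt_bounds(2) by (intro sum_mono) (smt (verit))
  then show ?thesis by (simp add: sum_distrib_left)
qed

text \<open>The variables other than \<open>i0\<close> have total degree \<open>s\<close> between 1
  and 5. The multinomial coefficient is then at least \<open>m choose \<alpha> i0\<close>, hence at
  least \<open>m\<close>. The loss 36 consists of \<open>1 + 5\<close> for the entropy of the
  exponents and \<open>15 + 15\<close> for the weights.\<close>

lemma gain_ge_near_diag:
  assumes \<alpha>: "\<alpha> \<in> multi_indices m n" and i0: "i0 < n"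
    and A: "1 \<le> \<alpha> i0" "\<alpha> i0 < m" "m \<le> \<alpha> i0 + 5"
  shows "gain m n \<alpha> \<ge> ln (real m) - 36"
proof -
  define J where "J = {..<n} - {i0}"
  define s where "s = (\<Sum>j\<in>J. \<alpha> j)"
  define t where "t i = real (\<alpha> i) / real m" for i
  have J: "{..<n} = insert i0 J" "i0 \<notin> J" "finite J" using i0 by (auto simp: J_def)
  have m: "m = \<alpha> i0 + s"
    using \<alpha> unfolding multi_indices_def J(1) s_def using J by simp
  have s: "s \<le> 5" "s \<ge> 1" using A m by auto
  have t: "0 \<le> t i" "t i \<le> 1" for i
    using multi_indices_le[OF \<alpha>, of i] A by (auto simp: t_def divide_simps)
  have "real m \<le> fact m / multi_fact n \<alpha>"
  proof -
    have "m choose 1 \<le> m choose \<alpha> i0" using A by (intro binomial_ge_choose) auto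
    then have "real m \<le> real (m choose \<alpha> i0)" by simp
    also have "\<dots> = fact m / (fact (\<alpha> i0) * fact s)"
      using m by (subst binomial_fact) auto
    also have "\<dots> \<le> fact m / (fact (\<alpha> i0) * (\<Prod>j\<in>J. fact (\<alpha> j)))"
      using prod_fact_le[OF J(3), of \<alpha>]
      by (intro divide_left_mono mult_left_mono mult_pos_pos prod_pos) (auto simp: s_def)
    finally show ?thesis unfolding multi_fact_def J(1) using J by simp
  qed
  then have N: "ln (real m) \<le> ln (fact m / multi_fact n \<alpha>)"
    using A by (subst ln_le_cancel_iff) auto
  have ent: "(\<Sum>i<n. t i * ln (t i)) \<ge> - 6"
  proof -
    have "- real (\<alpha> j) \<le> t j * ln (t j)" for j
      using mult_ln_self_ge[OF t(1), of j] by (cases "\<alpha> j = 0") (auto simp: t_def)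
    then have "(\<Sum>j\<in>J. - real (\<alpha> j)) \<le> (\<Sum>j\<in>J. t j * ln (t j))" by (intro sum_mono)
    then have "- real s \<le> (\<Sum>j\<in>J. t j * ln (t j))" by (simp add: s_def sum_negf)
    moreover have "t i0 * ln (t i0) \<ge> - 1" using t by (intro mult_ln_self_ge) auto
    ultimately show ?thesis unfolding J(1) using J s by simp
  qed
  have weights: "(\<Sum>i<n. t i * (\<Sum>j\<in>{..<n} - {i}. ln (wt (\<alpha> j)))) \<ge> - 30"
  proof -
    have "- (3 * real s) \<le> t i0 * (\<Sum>j\<in>J. ln (wt (\<alpha> j)))"
    proof -
      have "- (3 * real s) \<le> t i0 * (- (3 * real s))"
        using t(2)[of i0] by (simp add: mult_left_le_one_le t(1))
      also have "\<dots> \<le> t i0 * (\<Sum>j\<in>J. ln (wt (\<alpha> j)))"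
        using sum_ln_wt_ge[of \<alpha> J] t(1)[of i0] by (intro mult_left_mono) (auto simp: s_def)
      finally show ?thesis .
    qed
    \<comment> \<open>For these \<open>i\<close> the weight of the large variable \<open>i0\<close>
      does enter, and may cost a multiple of \<open>m\<close>; the small probability
      \<open>\<alpha> i / m\<close> compensates for it.\<close>
    moreover have "(\<Sum>i\<in>J. - 3 * real (\<alpha> i)) \<le> (\<Sum>i\<in>J. t i * (\<Sum>j\<in>{..<n} - {i}. ln (wt (\<alpha> j))))"
    proof (rule sum_mono)
      fix i
      have "(\<Sum>j\<in>{..<n} - {i}. \<alpha> j) \<le> (\<Sum>j<n. \<alpha> j)" by (rule sum_mono2) auto
      also have "\<dots> = m" using \<alpha> by (simp add: multi_indices_def)
      finally have "- 3 * real m \<le> (\<Sum>j\<in>{..<n} - {i}. ln (wt (\<alpha> j)))"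
        using sum_ln_wt_ge[of \<alpha> "{..<n} - {i}"]
        by (smt (verit) of_nat_mono)
      then have "t i * (- 3 * real m) \<le> t i * (\<Sum>j\<in>{..<n} - {i}. ln (wt (\<alpha> j)))"
        using t(1) by (intro mult_left_mono) auto
      then show "- 3 * real (\<alpha> i) \<le> t i * (\<Sum>j\<in>{..<n} - {i}. ln (wt (\<alpha> j)))"
        using A by (simp add: t_def)
    qed
    then have "- 3 * real s \<le> (\<Sum>i\<in>J. t i * (\<Sum>j\<in>{..<n} - {i}. ln (wt (\<alpha> j))))"
      by (simp add: s_def sum_distrib_left[symmetric] sum_negf)
    moreover have "(\<Sum>i<n. t i * (\<Sum>j\<in>{..<n} - {i}. ln (wt (\<alpha> j)))) =
        t i0 * (\<Sum>j\<in>J. ln (wt (\<alpha> j))) + (\<Sum>i\<in>J. t i * (\<Sum>j\<in>{..<n} - {i}. ln (wt (\<alpha> j))))"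
      using i0 unfolding J_def by (intro sum.remove) auto
    ultimately show ?thesis using s by simp
  qed
  have "gain m n \<alpha> = ln (fact m / multi_fact n \<alpha>) + (\<Sum>i<n. t i * ln (t i))
      + (\<Sum>i<n. t i * (\<Sum>j\<in>{..<n} - {i}. ln (wt (\<alpha> j))))"
    by (simp add: gain_def t_def distrib_left sum.distrib)
  then show ?thesis using N ent weights by linarith
qed

text \<open>Every nonzero probability \<open>\<alpha> i / m\<close> is at least
  \<open>1 / m\<close>, so the entropy term loses at most \<open>ln m\<close>. Inserting the omitted
  weight, which is at most 1, only lowers the sum and makes it independent of
  \<open>i\<close>.\<close>

lemma gain_ge_prod_dfac:
  assumes \<alpha>: "\<alpha> \<in> multi_indices m n" and m: "m \<ge> 1"
  shows "gain m n \<alpha> \<ge> ln (fact m / (\<Prod>j<n. dfac (\<alpha> j))) - ln (real m)"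
proof -
  define t where "t i = real (\<alpha> i) / real m" for i
  have sum_t: "(\<Sum>i<n. t i) = 1"
    using \<alpha> m by (simp add: t_def sum_divide_distrib[symmetric] multi_indices_def of_nat_sum[symmetric] del: of_nat_sum)
  have t: "0 \<le> t i" for i by (simp add: t_def)
  have "(\<Sum>i<n. t i * (- ln (real m))) \<le> (\<Sum>i<n. t i * ln (t i))"
  proof (rule sum_mono)
    fix i
    show "t i * (- ln (real m)) \<le> t i * ln (t i)"
    proof (cases "\<alpha> i = 0")
      case False
      then have "ln (1 / real m) \<le> ln (t i)"
        using m by (subst ln_le_cancel_iff) (auto simp: t_def divide_right_mono)
      then show ?thesis using t[of i] m by (intro mult_left_mono) (auto simp: ln_div)
    qed (simp add: t_def)
  qed
  then have ent: "- ln (real m) \<le> (\<Sum>i<n. t i * ln (t i))"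
    by (simp only: sum_distrib_right[symmetric] sum_t)
  have "(\<Sum>i<n. t i * (\<Sum>j<n. ln (wt (\<alpha> j)))) \<le> (\<Sum>i<n. t i * (\<Sum>j\<in>{..<n} - {i}. ln (wt (\<alpha> j))))"
  proof (intro sum_mono mult_left_mono t)
    fix i assume "i \<in> {..<n}"
    then have "(\<Sum>j<n. ln (wt (\<alpha> j))) = ln (wt (\<alpha> i)) + (\<Sum>j\<in>{..<n} - {i}. ln (wt (\<alpha> j)))"
      by (intro sum.remove) auto
    then show "(\<Sum>j<n. ln (wt (\<alpha> j))) \<le> (\<Sum>j\<in>{..<n} - {i}. ln (wt (\<alpha> j)))"
      using neg_ln_wt_bounds(1)[of "\<alpha> i"] by simp
  qed
  then have "(\<Sum>j<n. ln (wt (\<alpha> j))) \<le> (\<Sum>i<n. t i * (\<Sum>j\<in>{..<n} - {i}. ln (wt (\<alpha> j))))"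
    by (simp only: sum_distrib_right[symmetric] sum_t)
  moreover have "(\<Sum>j<n. ln (wt (\<alpha> j))) = ln (\<Prod>j<n. wt (\<alpha> j))"
    by (rule ln_prod[symmetric]) auto
  moreover have "gain m n \<alpha> = ln (fact m / multi_fact n \<alpha>) + (\<Sum>i<n. t i * ln (t i))
      + (\<Sum>i<n. t i * (\<Sum>j\<in>{..<n} - {i}. ln (wt (\<alpha> j))))"
    by (simp add: gain_def t_def distrib_left sum.distrib)
  ultimately have "gain m n \<alpha> \<ge>
      ln (fact m / multi_fact n \<alpha>) + ln (\<Prod>j<n. wt (\<alpha> j)) - ln (real m)"
    using ent by linarith
  also have "ln (fact m / multi_fact n \<alpha>) + ln (\<Prod>j<n. wt (\<alpha> j))
      = ln (fact m / multi_fact n \<alpha> * (\<Prod>j<n. wt (\<alpha> j)))"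
    by (intro ln_mult_pos[symmetric]) (auto simp: multi_fact_def intro!: prod_pos divide_pos_pos)
  also have "fact m / multi_fact n \<alpha> * (\<Prod>j<n. wt (\<alpha> j)) = fact m / (\<Prod>j<n. dfac (\<alpha> j))"
    by (simp add: multi_fact_def dfac_def prod_dividef)
  finally show ?thesis .
qed

text \<open>36 is the loss near pure powers. Inside the logarithm, the first term serves indices
  whose largest exponent is at least 6 and the second those with all exponents at most 5.\<close>

definition gain_const :: real where
  "gain_const = 36 + ln (48 * 6 ^ 6 + 4 * exp 16)"

text \<open>If the largest exponent is at least \<open>m - 5\<close>,
  \<open>gain_ge_near_diag\<close> applies. Otherwise \<open>fact m\<close> exceeds the product of
  the \<open>dfac\<close> values by a factor of order \<open>m ^ 2\<close>, one power of which
  survives in \<open>gain_ge_prod_dfac\<close>.\<close>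

lemma gain_ge:
  assumes \<alpha>: "\<alpha> \<in> multi_indices m n" and m: "m \<ge> 1" and nondiag: "\<And>i. i < n \<Longrightarrow> \<alpha> i \<noteq> m"
  shows "gain m n \<alpha> \<ge> ln (real m) - gain_const"
proof -
  have K1: "1 \<le> 48 * 6 ^ 6 + 4 * exp (16::real)" by (simp add: add_increasing2)
  have n: "n \<noteq> 0" using \<alpha> m by (cases n) (auto simp: multi_indices_def)
  then have "Max (\<alpha> ` {..<n}) \<in> \<alpha> ` {..<n}" by (intro Max_in) (auto simp: lessThan_empty_iff)
  then obtain i0 where i0: "i0 < n" "\<alpha> i0 = Max (\<alpha> ` {..<n})" by auto
  have max: "\<alpha> j \<le> \<alpha> i0" if "j < n" for j
    unfolding i0(2) using that by (intro Max_ge) auto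
  have "\<alpha> i0 \<noteq> 0"
  proof
    assume "\<alpha> i0 = 0"
    then have "(\<Sum>j<n. \<alpha> j) = 0" using max by auto
    then show False using \<alpha> m by (simp add: multi_indices_def)
  qed
  moreover have "\<alpha> i0 < m"
    using multi_indices_le[OF \<alpha>, of i0] nondiag[OF i0(1)] by simp
  ultimately have A: "1 \<le> \<alpha> i0" "\<alpha> i0 < m" by auto
  show ?thesis
  proof (cases "m \<le> \<alpha> i0 + 5")
    case True
    have "ln (48 * 6 ^ 6 + 4 * exp (16::real)) \<ge> 0" using K1 by (rule ln_ge_zero)
    with gain_ge_near_diag[OF \<alpha> i0(1) A True] show ?thesis
      unfolding gain_const_def by linarith
  next
    case False
    define J where "J = {..<n} - {i0}"
    define s where "s = (\<Sum>j\<in>J. \<alpha> j)"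
    have J: "{..<n} = insert i0 J" "i0 \<notin> J" "finite J" using i0 by (auto simp: J_def)
    have m_eq: "m = \<alpha> i0 + s"
      using \<alpha> unfolding multi_indices_def J(1) s_def using J by simp
    have s: "s \<ge> 6" using False m_eq by simp
    have pos: "(\<Prod>j<n. dfac (\<alpha> j)) > 0" by (intro prod_pos) auto
    have key: "(real m)\<^sup>2 * (\<Prod>j<n. dfac (\<alpha> j)) \<le> (48 * 6 ^ 6 + 4 * exp 16) * fact m"
    proof (cases "\<alpha> i0 \<ge> 6")
      case True
      let ?A = "\<alpha> i0"
      have "(\<Prod>j<n. dfac (\<alpha> j)) = dfac ?A * (\<Prod>j\<in>J. dfac (\<alpha> j))"
        unfolding J(1) using J by simp
      also have "\<dots> \<le> dfac ?A * (3 * dfac s)"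
      proof (rule mult_left_mono)
        have "8 ^ s \<le> 3 * dfac s" using s by (intro power_8_le_dfac) simp
        moreover have "dfac s \<le> 3 * dfac s" using dfac_pos[of s] by linarith
        ultimately show "(\<Prod>j\<in>J. dfac (\<alpha> j)) \<le> 3 * dfac s"
          using prod_dfac_le[OF J(3), of \<alpha>] unfolding s_def by linarith
      qed (simp add: less_imp_le)
      also have "\<dots> = 48 * (real ?A * (real ?A + 1)) * (real s * (real s + 1)) * (fact ?A * fact s)"
        using True s by (simp add: dfac_eq)
      also have "\<dots> \<le> 48 * (real m * real m) * (real m * real m) * (fact ?A * fact s)"
        using m_eq True s by (intro mult_mono mult_right_mono mult_nonneg_nonneg) auto
      finally have "(real m)\<^sup>2 * (\<Prod>j<n. dfac (\<alpha> j))
          \<le> (real m)\<^sup>2 * (48 * (real m * real m) * (real m * real m) * (fact ?A * fact s))"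
        by (intro mult_left_mono) auto
      \<comment> \<open>The wanted \<open>m ^ 2\<close> and the four factors \<open>m\<close> from
        the weights make \<open>m ^ 6\<close>. This is absorbed by \<open>m choose 6\<close>, hence
        the requirement that both \<open>\<alpha> i0\<close> and \<open>s\<close> be at least
        6.\<close>
      also have "\<dots> = 48 * 6 ^ 6 * ((real m / 6) ^ 6 * (fact ?A * fact s))"
      proof -
        have "x ^ 6 = x\<^sup>2 * (x * x) * (x * x)" for x :: real
          by (simp add: power2_eq_square power_numeral_reduce)
        then show ?thesis by (simp add: power_divide)
      qed
      also have "\<dots> \<le> 48 * 6 ^ 6 * (real (m choose ?A) * (fact ?A * fact s))"
      proof (intro mult_left_mono mult_right_mono)
        have "(real m / 6) ^ 6 \<le> real (m choose 6)"
          using binomial_ge_n_over_k_pow_k[of 6 m, where 'a = real] m_eq s by simp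
        also have "\<dots> \<le> real (m choose ?A)"
          using True s m_eq by (intro of_nat_mono binomial_ge_choose) auto
        finally show "(real m / 6) ^ 6 \<le> real (m choose ?A)" .
      qed auto
      also have "real (m choose ?A) * (fact ?A * fact s) = fact m"
        using m_eq by (subst binomial_fact) auto
      also have "48 * 6 ^ 6 * fact m \<le> (48 * 6 ^ 6 + 4 * exp 16) * (fact m :: real)"
        by (intro mult_right_mono) auto
      finally show ?thesis .
    next
      case False
      have "(\<Prod>j<n. dfac (\<alpha> j)) \<le> (\<Prod>j<n. 8 ^ \<alpha> j)"
      proof (rule prod_mono)
        fix j assume "j \<in> {..<n}"
        then have "\<alpha> j \<le> 5" using max[of j] False by simp
        then show "0 \<le> dfac (\<alpha> j) \<and> dfac (\<alpha> j) \<le> 8 ^ \<alpha> j"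
          by (simp add: dfac_le_power_8 less_imp_le)
      qed
      also have "\<dots> = 8 ^ m"
        using \<alpha> by (simp add: power_sum[symmetric] multi_indices_def)
      finally have "(real m)\<^sup>2 * (\<Prod>j<n. dfac (\<alpha> j)) \<le> (2 ^ m * 4) * 8 ^ m"
      proof (intro mult_mono)
        \<comment> \<open>Trading the square for a power of 2 leaves \<open>4 * 16 ^ m\<close>,
          which one term of the exponential series at 16 bounds by a multiple of
          \<open>fact m\<close>.\<close>
        have "m\<^sup>2 \<le> 4 * 2 ^ m"
        proof (induction m rule: less_induct)
          case (less m)
          show ?case
          proof (cases "m \<le> 3")
            case True
            then have "m = 0 \<or> m = 1 \<or> m = 2 \<or> m = 3" by linarith
            then show ?thesis by auto
          next
            case False
            then obtain k where k: "m = Suc k" "k \<ge> 3" by (cases m) auto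
            have "(Suc k)\<^sup>2 \<le> 2 * k\<^sup>2"
            proof -
              have "3 * k \<le> k * k" using k(2) by (rule mult_le_mono1)
              then have "2 * k + 1 \<le> k * k" using k(2) by linarith
              moreover have "(Suc k)\<^sup>2 = k * k + (2 * k + 1)" by (simp add: power2_eq_square)
              ultimately show ?thesis unfolding power2_eq_square[of k] by linarith
            qed
            also have "\<dots> \<le> 2 * (4 * 2 ^ k)" using less[of k] k by simp
            finally show ?thesis using k by simp
          qed
        qed
        then have "real (m\<^sup>2) \<le> real (4 * 2 ^ m)" by (rule of_nat_mono)
        then show "(real m)\<^sup>2 \<le> 2 ^ m * 4" by simp
      qed (auto simp: pos less_imp_le)
      also have "\<dots> = 4 * 16 ^ m" by (simp add: power_mult_distrib[symmetric])
      also have "\<dots> \<le> 4 * (exp 16 * fact m)"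
        using power_div_fact_le_exp[of 16 m] by (simp add: divide_simps)
      also have "\<dots> \<le> (48 * 6 ^ 6 + 4 * exp 16) * fact m"
        by (simp add: algebra_simps)
      finally show ?thesis .
    qed
    define K :: real where "K = 48 * 6 ^ 6 + 4 * exp 16"
    have K: "K > 0" using K1 unfolding K_def by linarith
    have "ln ((real m)\<^sup>2 / K) \<le> ln (fact m / (\<Prod>j<n. dfac (\<alpha> j)))"
    proof (subst ln_le_cancel_iff)
      show "(real m)\<^sup>2 / K \<le> fact m / (\<Prod>j<n. dfac (\<alpha> j))"
        using key pos K unfolding K_def[symmetric] by (simp add: field_simps)
    qed (use pos K m in auto)
    moreover have "ln ((real m)\<^sup>2 / K) = 2 * ln (real m) - ln K"
      using m K by (simp add: ln_div ln_realpow)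
    ultimately show ?thesis
      using gain_ge_prod_dfac[OF \<alpha> m] unfolding gain_const_def K_def[symmetric] by linarith
  qed
qed

subsection \<open>The entropy inequality\<close>

text \<open>Jensen's inequality for the concave logarithm, from \<open>ln x \<le> x - 1\<close> at
  \<open>x = y i / Y\<close>. Only an upper bound \<open>Y\<close> of the mean is known to the
  callers, so its positivity is part of the conclusion. Points of probability zero are
  unrestricted.\<close>

lemma weighted_ln_le:
  fixes p y :: "'a \<Rightarrow> real"
  assumes "finite A" "\<And>i. i \<in> A \<Longrightarrow> p i \<ge> 0" "(\<Sum>i\<in>A. p i) = 1" "\<And>i. i \<in> A \<Longrightarrow> p i > 0 \<Longrightarrow> y i > 0"
    and le: "(\<Sum>i\<in>A. p i * y i) \<le> Y"
  shows "Y > 0" "(\<Sum>i\<in>A. p i * ln (y i)) \<le> ln Y"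
proof -
  have "\<exists>i\<in>A. p i \<noteq> 0"
    using assms(3) by (metis sum.neutral zero_neq_one)
  then obtain i where i: "i \<in> A" "p i > 0" using assms(2) by (metis less_eq_real_def)
  have nonneg: "p i * y i \<ge> 0" if "i \<in> A" for i
    using assms(2,4)[OF that] by (cases "p i = 0") auto
  have "0 < p i * y i" using i assms(4) by simp
  also have "\<dots> \<le> (\<Sum>i\<in>A. p i * y i)"
    using i nonneg assms(1) by (intro member_le_sum) auto
  finally show Y: "Y > 0" using le by simp
  have "(\<Sum>i\<in>A. p i * ln (y i)) \<le> (\<Sum>i\<in>A. p i * (ln Y + (y i / Y - 1)))"
  proof (rule sum_mono)
    fix i assume i: "i \<in> A"
    show "p i * ln (y i) \<le> p i * (ln Y + (y i / Y - 1))"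
    proof (cases "p i = 0")
      case False
      then have p: "p i > 0" using assms(2)[OF i] by simp
      then have "y i > 0" using assms(4)[OF i] by simp
      then have "ln (y i / Y) \<le> y i / Y - 1" using Y by (intro ln_le_minus_one) simp
      then have "ln (y i) \<le> ln Y + (y i / Y - 1)"
        using \<open>y i > 0\<close> Y by (simp add: ln_div)
      then show ?thesis using p by (intro mult_left_mono) auto
    qed simp
  qed
  also have "\<dots> = (ln Y - 1) * (\<Sum>i\<in>A. p i) + (\<Sum>i\<in>A. p i * y i) / Y"
    by (simp add: sum_distrib_left sum_divide_distrib sum.distrib[symmetric] algebra_simps)
  also have "\<dots> \<le> (ln Y - 1) * 1 + 1"
    using le Y unfolding assms(3) by (intro add_left_mono) (simp add: divide_simps)
  finally show "(\<Sum>i\<in>A. p i * ln (y i)) \<le> ln Y" by simp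
qed

section \<open>The multinomial theorem\<close>

lemma multi_indices_0: "multi_indices m 0 = (if m = 0 then {\<lambda>_. 0} else {})"
  by (auto simp: multi_indices_def)

lemma sum_multi_indices_Suc:
  "(\<Sum>\<alpha>\<in>multi_indices m (Suc n). f \<alpha>) =
     (\<Sum>a\<le>m. \<Sum>\<alpha>\<in>multi_indices (m - a) n. f (fun_upd \<alpha> n a))"
proof -
  define S where "S a = {\<alpha>\<in>multi_indices m (Suc n). \<alpha> n = a}" for a
  have "(\<Sum>\<alpha>\<in>multi_indices m (Suc n). f \<alpha>) = (\<Sum>a\<le>m. \<Sum>\<alpha>\<in>S a. f \<alpha>)"
    unfolding S_def using multi_indices_le
    by (intro sum.group[symmetric] finite_multi_indices) auto
  also have "\<dots> = (\<Sum>a\<le>m. \<Sum>\<alpha>\<in>multi_indices (m - a) n. f (fun_upd \<alpha> n a))"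
  proof (rule sum.cong[OF refl])
    fix a assume a: "a \<in> {..m}"
    show "(\<Sum>\<alpha>\<in>S a. f \<alpha>) = (\<Sum>\<alpha>\<in>multi_indices (m - a) n. f (fun_upd \<alpha> n a))"
    proof (rule sum.reindex_bij_witness[of _ "\<lambda>\<alpha>. fun_upd \<alpha> n a" "\<lambda>\<alpha>. fun_upd \<alpha> n 0"])
      fix \<alpha> assume \<alpha>: "\<alpha> \<in> S a"
      then show "fun_upd (fun_upd \<alpha> n 0) n a = \<alpha>" by (auto simp: S_def)
      then show "f (fun_upd (fun_upd \<alpha> n 0) n a) = f \<alpha>" by (rule arg_cong)
      show "fun_upd \<alpha> n 0 \<in> multi_indices (m - a) n"
        using \<alpha> by (auto simp: S_def multi_indices_def)
    next
      fix \<alpha> assume \<alpha>: "\<alpha> \<in> multi_indices (m - a) n"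
      then have "\<alpha> n = 0" by (simp add: multi_indices_def)
      then show "fun_upd (fun_upd \<alpha> n a) n 0 = \<alpha>" by auto
      show "fun_upd \<alpha> n a \<in> S a"
        using \<alpha> a by (auto simp: S_def multi_indices_def)
    qed
  qed
  finally show ?thesis .
qed

text \<open>Divided by factorials, the sum splits over the last exponent into products, and the
  induction step is the binomial theorem.\<close>

lemma multinomial:
  fixes \<mu> :: "nat \<Rightarrow> real"
  shows "(\<Sum>\<alpha>\<in>multi_indices m n. (\<Prod>i<n. \<mu> i ^ \<alpha> i) / multi_fact n \<alpha>) = (\<Sum>i<n. \<mu> i) ^ m / fact m"
proof (induction n arbitrary: m)
  case 0
  then show ?case by (simp add: multi_indices_0 multi_fact_def power_0_left)
next
  case (Suc n)
  have "(\<Sum>\<alpha>\<in>multi_indices m (Suc n). (\<Prod>i<Suc n. \<mu> i ^ \<alpha> i) / multi_fact (Suc n) \<alpha>)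
     = (\<Sum>a\<le>m. \<Sum>\<alpha>\<in>multi_indices (m - a) n.
         \<mu> n ^ a / fact a * ((\<Prod>i<n. \<mu> i ^ \<alpha> i) / multi_fact n \<alpha>))"
    unfolding sum_multi_indices_Suc
    by (intro sum.cong refl) (simp add: multi_fact_def mult.commute)
  also have "\<dots> = (\<Sum>a\<le>m. \<mu> n ^ a / fact a * ((\<Sum>i<n. \<mu> i) ^ (m - a) / fact (m - a)))"
    by (simp only: sum_distrib_left[symmetric] Suc.IH)
  also have "\<dots> = (\<Sum>a\<le>m. of_nat (m choose a) * \<mu> n ^ a * (\<Sum>i<n. \<mu> i) ^ (m - a)) / fact m"
    unfolding sum_divide_distrib
    by (intro sum.cong refl) (simp add: binomial_fact field_simps)
  also have "\<dots> = (\<mu> n + (\<Sum>i<n. \<mu> i)) ^ m / fact m"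
    by (simp only: binomial_ring)
  finally show ?case by (simp add: add.commute)
qed

text \<open>Positivity is asked only where the exponent is nonzero, because the marginals \<mu> may
  vanish elsewhere.\<close>

lemma ln_prod_power:
  fixes x :: "nat \<Rightarrow> real"
  assumes "\<And>j. j < n \<Longrightarrow> \<alpha> j \<noteq> 0 \<Longrightarrow> x j > 0"
  shows "(\<Prod>j<n. x j ^ \<alpha> j) > 0" "ln (\<Prod>j<n. x j ^ \<alpha> j) = (\<Sum>j<n. real (\<alpha> j) * ln (x j))"
proof -
  have pos: "x j ^ \<alpha> j > 0" if "j < n" for j
    using assms[OF that] by (cases "\<alpha> j = 0") auto
  then show "(\<Prod>j<n. x j ^ \<alpha> j) > 0" by (intro prod_pos) auto
  have "x j ^ \<alpha> j \<noteq> 0" if "j < n" for j using pos[OF that] by (metis less_irrefl)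
  then have "ln (\<Prod>j<n. x j ^ \<alpha> j) = (\<Sum>j<n. ln (x j ^ \<alpha> j))"
    by (intro ln_prod) auto
  also have "\<dots> = (\<Sum>j<n. real (\<alpha> j) * ln (x j))"
  proof (rule sum.cong[OF refl])
    fix j assume "j \<in> {..<n}"
    then show "ln (x j ^ \<alpha> j) = real (\<alpha> j) * ln (x j)"
      using assms[of j] by (cases "\<alpha> j = 0") (auto simp: ln_realpow)
  qed
  finally show "ln (\<Prod>j<n. x j ^ \<alpha> j) = (\<Sum>j<n. real (\<alpha> j) * ln (x j))" .
qed

definition multinom :: "nat \<Rightarrow> nat \<Rightarrow> (nat \<Rightarrow> nat) \<Rightarrow> real" where
  "multinom m n \<alpha> = fact m / multi_fact n \<alpha>"

lemma multinom_pos [simp]: "multinom m n \<alpha> > 0"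
  by (simp add: multinom_def multi_fact_def prod_pos)

text \<open>For a probability vector \<mu> the right side is 1: the summands are the multinomial
  distribution with parameters \<mu>.\<close>

lemma sum_multinom_power:
  fixes \<mu> :: "nat \<Rightarrow> real"
  shows "(\<Sum>\<alpha>\<in>multi_indices m n. multinom m n \<alpha> * (\<Prod>i<n. \<mu> i ^ \<alpha> i)) = (\<Sum>i<n. \<mu> i) ^ m"
proof -
  have "(\<Sum>\<alpha>\<in>multi_indices m n. multinom m n \<alpha> * (\<Prod>i<n. \<mu> i ^ \<alpha> i))
      = fact m * (\<Sum>\<alpha>\<in>multi_indices m n. (\<Prod>i<n. \<mu> i ^ \<alpha> i) / multi_fact n \<alpha>)"
    unfolding sum_distrib_left by (simp add: multinom_def)
  then show ?thesis unfolding multinomial by simp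
qed

text \<open>
  The weights \<open>\<mu>\<close> at which the hypothesis is used are the marginals of the probability \<open>\<nu>\<close>
  proportional to the \<open>q\<close>-th powers. Jensen's inequality for the logarithm turns the hypothesis
  into an inequality between entropies, in which all terms but \<open>gain\<close> cancel because the relative
  entropy of \<open>\<nu>\<close> with respect to the multinomial distribution with parameters \<open>\<mu>\<close> is nonnegative.
\<close>

lemma entropy_bound:
  fixes b :: "(nat \<Rightarrow> nat) \<Rightarrow> complex"
  assumes m: "m \<ge> 1" and \<theta>: "\<theta> \<le> 1 / (2 * real m)"
    and q: "q > 0" "1 / q = 1 / 2 + 1 / (2 * real m) - \<theta>"
    and S: "S \<subseteq> multi_indices m n" "\<And>\<alpha>. \<alpha> \<in> S \<Longrightarrow> b \<alpha> \<noteq> 0"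
    and gain: "\<And>\<alpha>. \<alpha> \<in> S \<Longrightarrow> gain m n \<alpha> \<ge> G"
    and bd: "\<And>\<mu>. (\<And>i. \<mu> i \<ge> 0) \<Longrightarrow> (\<Sum>i<n. \<mu> i) = 1 \<Longrightarrow>
      (\<Sum>i<n. sqrt (\<Sum>\<alpha>\<in>multi_indices m n. (\<Prod>j\<in>{..<n} - {i}. wt (\<alpha> j)) *
        (real (\<alpha> i) * cmod (b \<alpha>) * (\<Prod>j<n. (\<mu> j powr \<theta>) ^ \<alpha> j))\<^sup>2)) \<le> real m * K"
    and R: "R = (\<Sum>\<alpha>\<in>S. multinom m n \<alpha> powr (1 - q) * cmod (b \<alpha>) powr q)" "R > 0"
  shows "K > 0 \<and> ln R / q + G / 2 \<le> ln K"
proof -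
  have finS: "finite S" using S(1) finite_multi_indices by (rule finite_subset)
  define N where "N = multinom m n"
  have N: "N \<alpha> > 0" for \<alpha> by (simp add: N_def)
  define \<nu> where "\<nu> \<alpha> = N \<alpha> powr (1 - q) * cmod (b \<alpha>) powr q / R" for \<alpha>
  have \<nu>: "\<nu> \<alpha> > 0" if "\<alpha> \<in> S" for \<alpha>
    using S(2)[OF that] R(2) N[of \<alpha>] by (simp add: \<nu>_def)
  have \<nu>_neq: "\<nu> \<alpha> \<noteq> 0" if "\<alpha> \<in> S" for \<alpha> using \<nu>[OF that] by simp
  have sum_\<nu>: "(\<Sum>\<alpha>\<in>S. \<nu> \<alpha>) = 1"
    using R by (simp add: \<nu>_def N_def sum_divide_distrib[symmetric])
  define t where "t \<alpha> i = real (\<alpha> i) / real m" for \<alpha> :: "nat \<Rightarrow> nat" and i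
  have t0: "t \<alpha> i \<ge> 0" for \<alpha> i by (simp add: t_def)
  have sum_t: "(\<Sum>i<n. t \<alpha> i) = 1" if "\<alpha> \<in> S" for \<alpha>
  proof -
    have "(\<Sum>i<n. real (\<alpha> i)) = real m"
      using that S(1) unfolding of_nat_sum[symmetric] by (auto simp: multi_indices_def)
    then show ?thesis using m by (simp add: t_def sum_divide_distrib[symmetric])
  qed
  define \<mu> where "\<mu> i = (\<Sum>\<alpha>\<in>S. \<nu> \<alpha> * t \<alpha> i)" for i
  have \<nu>t: "\<nu> \<alpha> * t \<alpha> i \<ge> 0" if "\<alpha> \<in> S" for \<alpha> i
    using \<nu>[OF that] t0 by simp
  have \<mu>0: "\<mu> i \<ge> 0" for i unfolding \<mu>_def by (intro sum_nonneg \<nu>t)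
  have sum_\<mu>: "(\<Sum>i<n. \<mu> i) = 1"
    unfolding \<mu>_def by (subst sum.swap) (simp add: sum_distrib_left[symmetric] sum_t sum_\<nu>)
  have \<mu>_pos: "\<mu> i > 0" if "\<alpha> \<in> S" "\<alpha> i \<noteq> 0" for \<alpha> i
  proof -
    have "0 < \<nu> \<alpha> * t \<alpha> i" using \<nu>[OF that(1)] that(2) m by (simp add: t_def)
    also have "\<dots> \<le> \<mu> i"
      unfolding \<mu>_def using that finS \<nu>t by (intro member_le_sum) auto
    finally show ?thesis .
  qed
  \<comment> \<open>\<open>E\<close> is minus the entropy of \<mu>; for \<alpha> in
    \<open>S\<close>, \<open>LM \<alpha>\<close> is the logarithm of the monomial \<alpha> at
    \<mu>.\<close>
  define E where "E = (\<Sum>i<n. \<mu> i * ln (\<mu> i))"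
  define LM where "LM \<alpha> = (\<Sum>j<n. real (\<alpha> j) * ln (\<mu> j))" for \<alpha> :: "nat \<Rightarrow> nat"
  have sum_LM: "(\<Sum>\<alpha>\<in>S. \<nu> \<alpha> * LM \<alpha>) = real m * E"
  proof -
    have "(\<Sum>\<alpha>\<in>S. \<nu> \<alpha> * LM \<alpha>) = (\<Sum>j<n. \<Sum>\<alpha>\<in>S. \<nu> \<alpha> * (real (\<alpha> j) * ln (\<mu> j)))"
      unfolding LM_def sum_distrib_left by (rule sum.swap)
    also have "\<dots> = (\<Sum>j<n. real m * (\<mu> j * ln (\<mu> j)))"
      unfolding \<mu>_def sum_distrib_left sum_distrib_right using m
      by (intro sum.cong refl) (simp add: t_def)
    finally show ?thesis by (simp add: E_def sum_distrib_left)
  qed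
  have KL: "(\<Sum>\<alpha>\<in>S. \<nu> \<alpha> * ln (N \<alpha>)) + real m * E \<le> (\<Sum>\<alpha>\<in>S. \<nu> \<alpha> * ln (\<nu> \<alpha>))"
  proof -
    define M where "M \<alpha> = (\<Prod>j<n. \<mu> j ^ \<alpha> j)" for \<alpha>
    have M: "M \<alpha> > 0" "ln (M \<alpha>) = LM \<alpha>" if "\<alpha> \<in> S" for \<alpha>
      unfolding M_def LM_def using \<mu>_pos[OF that] by (auto intro!: ln_prod_power)
    have "(\<Sum>\<alpha>\<in>S. \<nu> \<alpha> * (N \<alpha> * M \<alpha> / \<nu> \<alpha>)) = (\<Sum>\<alpha>\<in>S. N \<alpha> * M \<alpha>)"
      using \<nu>_neq by (intro sum.cong refl) simp
    also have "\<dots> \<le> (\<Sum>\<alpha>\<in>multi_indices m n. N \<alpha> * M \<alpha>)"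
      using S(1) N \<mu>0 by (intro sum_mono2 finite_multi_indices)
        (auto simp: M_def less_imp_le intro!: mult_nonneg_nonneg prod_nonneg)
    also have "\<dots> = 1"
      unfolding N_def M_def sum_multinom_power sum_\<mu> by simp
    finally have "(\<Sum>\<alpha>\<in>S. \<nu> \<alpha> * ln (N \<alpha> * M \<alpha> / \<nu> \<alpha>)) \<le> ln 1"
      using finS \<nu> sum_\<nu> N M(1) by (intro weighted_ln_le(2)) (auto simp: less_imp_le)
    also have "(\<Sum>\<alpha>\<in>S. \<nu> \<alpha> * ln (N \<alpha> * M \<alpha> / \<nu> \<alpha>)) =
        (\<Sum>\<alpha>\<in>S. \<nu> \<alpha> * ln (N \<alpha>) + \<nu> \<alpha> * LM \<alpha> - \<nu> \<alpha> * ln (\<nu> \<alpha>))"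
    proof (rule sum.cong[OF refl])
      fix \<alpha> assume \<alpha>: "\<alpha> \<in> S"
      have ln_eq: "ln (N \<alpha> * M \<alpha> / \<nu> \<alpha>) = ln (N \<alpha>) + ln (M \<alpha>) - ln (\<nu> \<alpha>)"
        using N[of \<alpha>] M(1)[OF \<alpha>] \<nu>[OF \<alpha>] by (simp add: ln_div ln_mult_pos)
      show "\<nu> \<alpha> * ln (N \<alpha> * M \<alpha> / \<nu> \<alpha>) = \<nu> \<alpha> * ln (N \<alpha>) + \<nu> \<alpha> * LM \<alpha> - \<nu> \<alpha> * ln (\<nu> \<alpha>)"
        unfolding ln_eq M(2)[OF \<alpha>] by (simp add: algebra_simps)
    qed
    finally show ?thesis
      by (simp add: sum.distrib sum_subtractf sum_LM)
  qed
  \<comment> \<open>The summand of the hypothesis with \<alpha> \<open>i\<close> replaced by the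
    probability \<open>t \<alpha> i\<close>; this cancels the factor \<open>m\<close> on its right
    side.\<close>
  define h where "h i \<alpha> = (\<Prod>j\<in>{..<n} - {i}. wt (\<alpha> j)) *
      (t \<alpha> i * cmod (b \<alpha>) * (\<Prod>j<n. (\<mu> j powr \<theta>) ^ \<alpha> j))\<^sup>2" for i \<alpha>
  have h0: "h i \<alpha> \<ge> 0" for i \<alpha>
    unfolding h_def by (intro mult_nonneg_nonneg prod_nonneg) auto
  define H where "H i = (\<Sum>\<alpha>\<in>multi_indices m n. h i \<alpha>)" for i
  have sum_H: "(\<Sum>i<n. sqrt (H i)) \<le> K"
  proof -
    have "sqrt (\<Sum>\<alpha>\<in>multi_indices m n. (\<Prod>j\<in>{..<n} - {i}. wt (\<alpha> j)) *
        (real (\<alpha> i) * cmod (b \<alpha>) * (\<Prod>j<n. (\<mu> j powr \<theta>) ^ \<alpha> j))\<^sup>2) = real m * sqrt (H i)" for i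
    proof -
      have "(\<Sum>\<alpha>\<in>multi_indices m n. (\<Prod>j\<in>{..<n} - {i}. wt (\<alpha> j)) *
        (real (\<alpha> i) * cmod (b \<alpha>) * (\<Prod>j<n. (\<mu> j powr \<theta>) ^ \<alpha> j))\<^sup>2) = (real m)\<^sup>2 * H i"
        unfolding H_def h_def t_def sum_distrib_left using m
        by (intro sum.cong refl) (simp add: power_mult_distrib power_divide)
      then show ?thesis by (simp add: real_sqrt_mult)
    qed
    then have "real m * (\<Sum>i<n. sqrt (H i)) \<le> real m * K"
      using bd[OF \<mu>0 sum_\<mu>] by (simp add: sum_distrib_left)
    then show ?thesis using m by simp
  qed
  define L where "L i \<alpha> = ln (h i \<alpha> / (\<nu> \<alpha> * t \<alpha> i))" for i \<alpha>
  have h_pos: "h i \<alpha> > 0" if "\<alpha> \<in> S" "t \<alpha> i \<noteq> 0" for i \<alpha>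
  proof -
    have P: "(\<Prod>j<n. (\<mu> j powr \<theta>) ^ \<alpha> j) > 0"
    proof (rule ln_prod_power(1))
      fix j assume "\<alpha> j \<noteq> 0"
      then have "\<mu> j > 0" by (rule \<mu>_pos[OF that(1)])
      then show "\<mu> j powr \<theta> > 0" by simp
    qed
    have ti: "t \<alpha> i > 0" using that(2) t0[of \<alpha> i] by linarith
    have "cmod (b \<alpha>) > 0" using S(2)[OF that(1)] by simp
    then have pos: "t \<alpha> i * cmod (b \<alpha>) * (\<Prod>j<n. (\<mu> j powr \<theta>) ^ \<alpha> j) > 0"
      by (intro mult_pos_pos ti P)
    show ?thesis
      unfolding h_def by (rule mult_pos_pos[OF prod_pos zero_less_power[OF pos]]) simp
  qed
  \<comment> \<open>The first of two applications of Jensen: over \<alpha> for fixed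
    \<open>i\<close>, with \<open>?p\<close> the conditional distribution of \<alpha> given
    \<open>i\<close>. Afterwards \<open>K_lnK\<close> averages over \<open>i\<close> with
    distribution \<mu>. The factor 2 comes from the square root.\<close>
  have inner: "sqrt (H i) / \<mu> i > 0"
      "(\<Sum>\<alpha>\<in>S. \<nu> \<alpha> * t \<alpha> i * L i \<alpha>) - \<mu> i * ln (\<mu> i) \<le> 2 * (\<mu> i * ln (sqrt (H i) / \<mu> i))"
    if \<mu>i: "\<mu> i > 0" for i
  proof -
    let ?p = "\<lambda>\<alpha>. \<nu> \<alpha> * t \<alpha> i / \<mu> i"
    have "(\<Sum>\<alpha>\<in>S. ?p \<alpha> * (h i \<alpha> / (\<nu> \<alpha> * t \<alpha> i))) \<le> (\<Sum>\<alpha>\<in>S. h i \<alpha> / \<mu> i)"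
      using \<mu>i h0 by (intro sum_mono) (auto simp: divide_simps)
    also have "\<dots> \<le> (\<Sum>\<alpha>\<in>multi_indices m n. h i \<alpha> / \<mu> i)"
      using S(1) h0 \<mu>i by (intro sum_mono2 finite_multi_indices) auto
    finally have le: "(\<Sum>\<alpha>\<in>S. ?p \<alpha> * (h i \<alpha> / (\<nu> \<alpha> * t \<alpha> i))) \<le> H i / \<mu> i"
      by (simp add: H_def sum_divide_distrib)
    have p: "\<And>\<alpha>. \<alpha> \<in> S \<Longrightarrow> ?p \<alpha> \<ge> 0" "(\<Sum>\<alpha>\<in>S. ?p \<alpha>) = 1"
      using \<nu>t \<mu>i by (auto simp: sum_divide_distrib[symmetric] \<mu>_def[symmetric])
    have y: "h i \<alpha> / (\<nu> \<alpha> * t \<alpha> i) > 0" if "\<alpha> \<in> S" "?p \<alpha> > 0" for \<alpha>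
    proof -
      have ti: "t \<alpha> i \<noteq> 0" using that by auto
      then have "t \<alpha> i > 0" using t0[of \<alpha> i] by linarith
      with h_pos[OF that(1) ti] \<nu>[OF that(1)] show ?thesis by simp
    qed
    have HY: "H i / \<mu> i > 0" by (rule weighted_ln_le(1)[OF finS p y le])
    then have H: "H i > 0" using \<mu>i by (simp add: zero_less_divide_iff)
    then show "sqrt (H i) / \<mu> i > 0" using \<mu>i by simp
    have "(\<Sum>\<alpha>\<in>S. ?p \<alpha> * L i \<alpha>) \<le> ln (H i / \<mu> i)"
      unfolding L_def by (rule weighted_ln_le(2)[OF finS p y le])
    then have "\<mu> i * (\<Sum>\<alpha>\<in>S. ?p \<alpha> * L i \<alpha>) \<le> \<mu> i * ln (H i / \<mu> i)"
      using \<mu>i by (intro mult_left_mono) auto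
    moreover have "\<mu> i * (\<Sum>\<alpha>\<in>S. ?p \<alpha> * L i \<alpha>) = (\<Sum>\<alpha>\<in>S. \<nu> \<alpha> * t \<alpha> i * L i \<alpha>)"
      using \<mu>i by (simp add: sum_distrib_left)
    ultimately have "(\<Sum>\<alpha>\<in>S. \<nu> \<alpha> * t \<alpha> i * L i \<alpha>) \<le> \<mu> i * ln (H i / \<mu> i)" by linarith
    moreover have "ln (sqrt (H i) / \<mu> i) = ln (H i) / 2 - ln (\<mu> i)"
      using H \<mu>i by (simp add: ln_div ln_sqrt)
    then have "2 * (\<mu> i * ln (sqrt (H i) / \<mu> i)) = \<mu> i * ln (H i) - 2 * (\<mu> i * ln (\<mu> i))"
      by (simp add: right_diff_distrib)
    moreover have "ln (H i / \<mu> i) = ln (H i) - ln (\<mu> i)"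
      using H \<mu>i by (simp add: ln_div)
    then have "\<mu> i * ln (H i / \<mu> i) = \<mu> i * ln (H i) - \<mu> i * ln (\<mu> i)"
      by (simp add: right_diff_distrib)
    ultimately show "(\<Sum>\<alpha>\<in>S. \<nu> \<alpha> * t \<alpha> i * L i \<alpha>) - \<mu> i * ln (\<mu> i) \<le> 2 * (\<mu> i * ln (sqrt (H i) / \<mu> i))"
      by linarith
  qed
  \<comment> \<open>Only an inequality, since division by zero makes the left summand vanish where
    \<open>\<mu> i = 0\<close>.\<close>
  have outer: "(\<Sum>i<n. \<mu> i * (sqrt (H i) / \<mu> i)) \<le> K"
  proof -
    have "(\<Sum>i<n. \<mu> i * (sqrt (H i) / \<mu> i)) \<le> (\<Sum>i<n. sqrt (H i))"
      by (intro sum_mono) (auto simp: H_def h0 sum_nonneg)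
    then show ?thesis using sum_H by linarith
  qed
  have K_lnK: "K > 0 \<and> (\<Sum>i<n. \<mu> i * ln (sqrt (H i) / \<mu> i)) \<le> ln K"
    using weighted_ln_le[where A = "{..<n}" and p = \<mu> and y = "\<lambda>i. sqrt (H i) / \<mu> i" and Y = K]
      \<mu>0 sum_\<mu> inner(1) outer by auto
  then have lnK: "(\<Sum>i<n. \<mu> i * ln (sqrt (H i) / \<mu> i)) \<le> ln K" by simp
  have "(\<Sum>i<n. (\<Sum>\<alpha>\<in>S. \<nu> \<alpha> * t \<alpha> i * L i \<alpha>) - \<mu> i * ln (\<mu> i))
      \<le> (\<Sum>i<n. 2 * (\<mu> i * ln (sqrt (H i) / \<mu> i)))"
  proof (rule sum_mono)
    fix i
    show "(\<Sum>\<alpha>\<in>S. \<nu> \<alpha> * t \<alpha> i * L i \<alpha>) - \<mu> i * ln (\<mu> i) \<le> 2 * (\<mu> i * ln (sqrt (H i) / \<mu> i))"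
    proof (cases "\<mu> i = 0")
      case True
      then have "\<nu> \<alpha> * t \<alpha> i = 0" if "\<alpha> \<in> S" for \<alpha>
        using that finS \<nu>t unfolding \<mu>_def by (subst (asm) sum_nonneg_eq_0_iff) auto
      then have "(\<Sum>\<alpha>\<in>S. \<nu> \<alpha> * t \<alpha> i * L i \<alpha>) = 0" by (intro sum.neutral) simp
      then show ?thesis using True by simp
    next
      case False
      then show ?thesis using \<mu>0[of i] by (intro inner(2)) linarith
    qed
  qed
  also have "\<dots> \<le> 2 * ln K" using lnK by (simp add: sum_distrib_left[symmetric])
  finally have "(\<Sum>i<n. \<Sum>\<alpha>\<in>S. \<nu> \<alpha> * t \<alpha> i * L i \<alpha>) - E \<le> 2 * ln K"
    by (simp add: sum_subtractf E_def)
  moreover have "(\<Sum>i<n. \<Sum>\<alpha>\<in>S. \<nu> \<alpha> * t \<alpha> i * L i \<alpha>) = (\<Sum>\<alpha>\<in>S. \<nu> \<alpha> * (\<Sum>i<n. t \<alpha> i * L i \<alpha>))"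
    by (subst sum.swap) (simp add: sum_distrib_left mult.assoc)
  moreover have "(\<Sum>i<n. t \<alpha> i * L i \<alpha>) =
      gain m n \<alpha> + 2 / q * ln R + (1 - 2 / q) * ln (N \<alpha>) + (2 / q - 1) * ln (\<nu> \<alpha>) + 2 * \<theta> * LM \<alpha>"
    if \<alpha>: "\<alpha> \<in> S" for \<alpha>
  proof -
    \<comment> \<open>The part of \<open>L i \<alpha>\<close> that is independent of
      \<open>i\<close>, which passes unchanged through the average with weights
      \<open>t \<alpha> i\<close>. The remaining part averages to \<open>gain\<close> minus
      \<open>ln (N \<alpha>)\<close>.\<close>
    define c where "c = 2 * ln (cmod (b \<alpha>)) + 2 * \<theta> * LM \<alpha> - ln (\<nu> \<alpha>)"
    have b_pos: "cmod (b \<alpha>) > 0" using S(2)[OF \<alpha>] by simp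
    have tL: "t \<alpha> i * L i \<alpha> =
        t \<alpha> i * (ln (t \<alpha> i) + (\<Sum>j\<in>{..<n} - {i}. ln (wt (\<alpha> j)))) + t \<alpha> i * c" for i
    proof (cases "t \<alpha> i = 0")
      case False
      then have ti: "t \<alpha> i > 0" using t0[of \<alpha> i] by linarith
      define P where "P = (\<Prod>j<n. (\<mu> j powr \<theta>) ^ \<alpha> j)"
      have \<mu>_powr: "\<mu> j powr \<theta> > 0" if "\<alpha> j \<noteq> 0" for j
        using \<mu>_pos[of \<alpha> j, OF \<alpha> that] by simp
      have P: "P > 0" "ln P = (\<Sum>j<n. real (\<alpha> j) * ln (\<mu> j powr \<theta>))"
        unfolding P_def by (rule ln_prod_power, erule \<mu>_powr)+
      have lnP: "ln P = \<theta> * LM \<alpha>"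
        unfolding P(2) LM_def sum_distrib_left
      proof (rule sum.cong[OF refl])
        fix j show "real (\<alpha> j) * ln (\<mu> j powr \<theta>) = \<theta> * (real (\<alpha> j) * ln (\<mu> j))"
          using \<mu>_pos[OF \<alpha>, of j] by (cases "\<alpha> j = 0") (auto simp: ln_powr)
      qed
      define W where "W = (\<Prod>j\<in>{..<n} - {i}. wt (\<alpha> j))"
      have W: "W > 0" "ln W = (\<Sum>j\<in>{..<n} - {i}. ln (wt (\<alpha> j)))"
        unfolding W_def by (auto intro!: prod_pos ln_prod)
      have pos: "t \<alpha> i * cmod (b \<alpha>) * P > 0" using ti b_pos P(1) by simp
      have "L i \<alpha> = ln (W * (t \<alpha> i * cmod (b \<alpha>) * P)\<^sup>2) - ln (\<nu> \<alpha> * t \<alpha> i)"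
        unfolding L_def h_def P_def[symmetric] W_def[symmetric]
        by (rule ln_divide_pos[OF mult_pos_pos[OF W(1) zero_less_power[OF pos]]
              mult_pos_pos[OF \<nu>[OF \<alpha>] ti]])
      also have "ln (W * (t \<alpha> i * cmod (b \<alpha>) * P)\<^sup>2) = ln W + ln ((t \<alpha> i * cmod (b \<alpha>) * P)\<^sup>2)"
        by (rule ln_mult_pos[OF W(1) zero_less_power[OF pos]])
      also have "ln ((t \<alpha> i * cmod (b \<alpha>) * P)\<^sup>2) = 2 * ln (t \<alpha> i * cmod (b \<alpha>) * P)"
        by (simp only: ln_realpow of_nat_numeral)
      also have "ln (t \<alpha> i * cmod (b \<alpha>) * P) = ln (t \<alpha> i) + ln (cmod (b \<alpha>)) + ln P"
        using ti b_pos P(1) by (simp add: ln_mult_pos)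
      also have "ln (\<nu> \<alpha> * t \<alpha> i) = ln (\<nu> \<alpha>) + ln (t \<alpha> i)"
        using ti \<nu>[OF \<alpha>] by (simp add: ln_mult_pos)
      finally have "L i \<alpha> = ln (t \<alpha> i) + ln W + c"
        by (simp add: c_def lnP)
      then show ?thesis by (simp add: W(2) algebra_simps)
    qed simp
    have "(\<Sum>i<n. t \<alpha> i * L i \<alpha>) = gain m n \<alpha> - ln (N \<alpha>) + (\<Sum>i<n. t \<alpha> i) * c"
      unfolding tL sum.distrib sum_distrib_right[symmetric]
      by (simp add: gain_def t_def N_def multinom_def)
    also have "\<dots> = gain m n \<alpha> - ln (N \<alpha>) + c" by (simp add: sum_t[OF \<alpha>])
    finally have sum_tL: "(\<Sum>i<n. t \<alpha> i * L i \<alpha>) = gain m n \<alpha> - ln (N \<alpha>) + c" .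
    \<comment> \<open>Logarithms in the definition of \<nu> eliminate the coefficient in favour of
      \<nu>, \<open>N\<close> and \<open>R\<close>.\<close>
    have "ln (\<nu> \<alpha>) = ln (N \<alpha> powr (1 - q) * cmod (b \<alpha>) powr q) - ln R"
      unfolding \<nu>_def using N[of \<alpha>] b_pos R(2) by (intro ln_divide_pos) auto
    also have "ln (N \<alpha> powr (1 - q) * cmod (b \<alpha>) powr q) = (1 - q) * ln (N \<alpha>) + q * ln (cmod (b \<alpha>))"
      using N[of \<alpha>] b_pos by (subst ln_mult_pos) auto
    finally have "q * ln (cmod (b \<alpha>)) = ln (\<nu> \<alpha>) + ln R + (q - 1) * ln (N \<alpha>)"
      by (simp add: algebra_simps)
    then have "ln (cmod (b \<alpha>)) = (ln (\<nu> \<alpha>) + ln R + (q - 1) * ln (N \<alpha>)) / q"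
      using q(1) by (simp add: eq_divide_eq mult.commute)
    also have "\<dots> = ln (\<nu> \<alpha>) / q + ln R / q + (1 - 1 / q) * ln (N \<alpha>)"
      using q(1) by (simp add: add_divide_distrib diff_divide_distrib left_diff_distrib)
    finally have ln_b: "ln (cmod (b \<alpha>)) = ln (\<nu> \<alpha>) / q + ln R / q + (1 - 1 / q) * ln (N \<alpha>)" .
    show ?thesis
      unfolding sum_tL c_def ln_b by (simp add: algebra_simps)
  qed
  ultimately have bound: "(\<Sum>\<alpha>\<in>S. \<nu> \<alpha> * (gain m n \<alpha> + 2 / q * ln R + (1 - 2 / q) * ln (N \<alpha>)
      + (2 / q - 1) * ln (\<nu> \<alpha>) + 2 * \<theta> * LM \<alpha>)) - E \<le> 2 * ln K"
    by simp
  have expand: "(\<Sum>\<alpha>\<in>S. \<nu> \<alpha> * (gain m n \<alpha> + 2 / q * ln R + (1 - 2 / q) * ln (N \<alpha>)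
      + (2 / q - 1) * ln (\<nu> \<alpha>) + 2 * \<theta> * LM \<alpha>)) =
      (\<Sum>\<alpha>\<in>S. \<nu> \<alpha> * gain m n \<alpha>) + 2 / q * ln R * (\<Sum>\<alpha>\<in>S. \<nu> \<alpha>)
      + (1 - 2 / q) * (\<Sum>\<alpha>\<in>S. \<nu> \<alpha> * ln (N \<alpha>)) + (2 / q - 1) * (\<Sum>\<alpha>\<in>S. \<nu> \<alpha> * ln (\<nu> \<alpha>))
      + 2 * \<theta> * (\<Sum>\<alpha>\<in>S. \<nu> \<alpha> * LM \<alpha>)"
    unfolding sum_distrib_left sum.distrib[symmetric]
    by (intro sum.cong refl) (simp add: algebra_simps)
  have main: "(\<Sum>\<alpha>\<in>S. \<nu> \<alpha> * gain m n \<alpha>) + 2 / q * ln R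
      + (2 / q - 1) * ((\<Sum>\<alpha>\<in>S. \<nu> \<alpha> * ln (\<nu> \<alpha>)) - (\<Sum>\<alpha>\<in>S. \<nu> \<alpha> * ln (N \<alpha>)))
      + (2 * \<theta> * real m - 1) * E \<le> 2 * ln K"
    using bound unfolding expand sum_\<nu> sum_LM by (simp add: algebra_simps)
  \<comment> \<open>The relation between \<open>q\<close> and \<theta> enters here: by
    \<open>KL\<close> the third summand of \<open>main\<close> is at least
    \<open>(2 / q - 1) * (m * E)\<close>, which cancels the term with \<open>E\<close> exactly. The
    bound on \<theta> makes the factor \<open>2 / q - 1\<close> nonnegative.\<close>
  have q2: "2 / q - 1 = 1 / real m - 2 * \<theta>"
    using q(2) by (simp add: field_simps)
  have "(2 / q - 1) * (real m * E)
      \<le> (2 / q - 1) * ((\<Sum>\<alpha>\<in>S. \<nu> \<alpha> * ln (\<nu> \<alpha>)) - (\<Sum>\<alpha>\<in>S. \<nu> \<alpha> * ln (N \<alpha>)))"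
    using KL \<theta> unfolding q2 by (intro mult_left_mono) (auto simp: field_simps)
  moreover have "(2 / q - 1) * (real m * E) = (1 - 2 * \<theta> * real m) * E"
    unfolding q2 using m by (simp add: field_simps)
  moreover have "G \<le> (\<Sum>\<alpha>\<in>S. \<nu> \<alpha> * gain m n \<alpha>)"
  proof -
    have "(\<Sum>\<alpha>\<in>S. \<nu> \<alpha> * G) \<le> (\<Sum>\<alpha>\<in>S. \<nu> \<alpha> * gain m n \<alpha>)"
      using gain \<nu> by (intro sum_mono mult_left_mono) (auto simp: less_imp_le)
    then show ?thesis by (simp add: sum_distrib_right[symmetric] sum_\<nu>)
  qed
  ultimately have "G + 2 / q * ln R \<le> 2 * ln K"
    using main by (simp add: algebra_simps)
  then show ?thesis using K_lnK by simp
qed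

subsection \<open>The Bombieri norm\<close>

text \<open>Test the hypothesis at \<mu> proportional to the \<open>q\<close>-th powers. Then
  \<open>c i\<close> is \<open>(\<mu> i * D) powr (1 / q)\<close>, and since
  \<open>\<theta> * m + 1 / q\<close> is at most 1 while \<open>\<mu> i\<close> is at most 1, each
  summand is at least \<open>D powr (1 / q) * \<mu> i\<close>.\<close>

lemma diag_powr_sum_le:
  fixes c :: "nat \<Rightarrow> real"
  assumes m: "m \<ge> 1" and \<theta>: "\<theta> \<le> 1 / (2 * real m)"
    and q: "q > 0" "1 / q = 1 / 2 + 1 / (2 * real m) - \<theta>"
    and bd: "\<And>\<mu>. (\<And>i. \<mu> i \<ge> 0) \<Longrightarrow> (\<Sum>i<n. \<mu> i) = 1 \<Longrightarrow>
      (\<Sum>i<n. (\<mu> i powr \<theta>) ^ m * c i) \<le> B"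
    and c: "\<And>i. c i \<ge> 0"
  shows "(\<Sum>i<n. c i powr q) \<le> B powr q"
proof (cases "(\<Sum>i<n. c i powr q) = 0")
  case False
  define D where "D = (\<Sum>i<n. c i powr q)"
  have "D \<ge> 0" unfolding D_def by (intro sum_nonneg) auto
  with False have D: "D > 0" by (simp add: D_def)
  define \<mu> where "\<mu> i = (if i < n then c i powr q / D else 0)" for i
  have \<mu>0: "\<mu> i \<ge> 0" for i using D by (simp add: \<mu>_def)
  have sum_\<mu>: "(\<Sum>i<n. \<mu> i) = 1"
    using D by (simp add: \<mu>_def sum_divide_distrib[symmetric]) (simp add: D_def)
  have exponent: "\<theta> * real m + 1 / q \<le> 1"
  proof -
    have "(real m - 1) * \<theta> \<le> (real m - 1) * (1 / (2 * real m))"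
      using \<theta> m by (intro mult_left_mono) auto
    also have "\<dots> = 1 / 2 - 1 / (2 * real m)" using m by (simp add: field_simps)
    finally show ?thesis unfolding q(2) by (simp add: algebra_simps)
  qed
  have "(\<Sum>i<n. D powr (1 / q) * \<mu> i) \<le> (\<Sum>i<n. (\<mu> i powr \<theta>) ^ m * c i)"
  proof (rule sum_mono)
    fix i assume i: "i \<in> {..<n}"
    show "D powr (1 / q) * \<mu> i \<le> (\<mu> i powr \<theta>) ^ m * c i"
    proof (cases "c i = 0")
      case True
      then show ?thesis by (simp add: \<mu>_def)
    next
      case False
      then have ci: "c i > 0" using c[of i] by simp
      have \<mu>i: "\<mu> i = c i powr q / D" using i by (simp add: \<mu>_def)
      then have \<mu>_pos: "\<mu> i > 0" using ci D by simp
      have "\<mu> i \<le> (\<Sum>i<n. \<mu> i)" using i \<mu>0 by (intro member_le_sum) auto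
      then have \<mu>_le: "\<mu> i \<le> 1" by (simp add: sum_\<mu>)
      have "c i = (\<mu> i * D) powr (1 / q)"
        using ci D q(1) by (simp add: \<mu>i powr_powr)
      also have "\<dots> = \<mu> i powr (1 / q) * D powr (1 / q)"
        using \<mu>_pos D by (simp add: powr_mult)
      finally have ceq: "c i = \<mu> i powr (1 / q) * D powr (1 / q)" .
      have "\<mu> i powr 1 \<le> \<mu> i powr (\<theta> * real m + 1 / q)"
        using exponent \<mu>_pos \<mu>_le by (intro powr_mono') auto
      also have "\<dots> = (\<mu> i powr \<theta>) ^ m * \<mu> i powr (1 / q)"
        using \<mu>_pos by (simp add: powr_add powr_powr[symmetric] powr_realpow)
      finally have "\<mu> i * D powr (1 / q) \<le> (\<mu> i powr \<theta>) ^ m * \<mu> i powr (1 / q) * D powr (1 / q)"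
        using \<mu>_pos by (intro mult_right_mono) auto
      then show ?thesis by (subst ceq) (simp add: mult_ac)
    qed
  qed
  also have "\<dots> \<le> B" by (rule bd[OF \<mu>0 sum_\<mu>])
  finally have "D powr (1 / q) \<le> B" by (simp add: sum_distrib_left[symmetric] sum_\<mu>)
  then have "(D powr (1 / q)) powr q \<le> B powr q" using q(1) by (intro powr_mono2) auto
  then show ?thesis using D q(1) by (simp add: powr_powr D_def)
qed simp

lemma multinom_diag_index: "i < n \<Longrightarrow> multinom m n (diag_index m i) = 1"
proof -
  assume "i < n"
  have "multi_fact n (diag_index m i) = (\<Prod>j<n. if j = i then fact m else 1)"
    unfolding multi_fact_def by (intro prod.cong) (auto simp: diag_index_def)
  with \<open>i < n\<close> show ?thesis by (simp add: multinom_def)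
qed

text \<open>The pure powers contribute at most \<open>B powr q\<close> and the remaining monomials
  \<open>O(1 / m)\<close> times that. The hypothesis \<open>bd\<close> is used with
  \<open>r = 1\<close> for the former and \<open>r = 1 + 1 / m\<close> for the gradient.\<close>

lemma bombieri_norm_le:
  assumes m: "m \<ge> 1" and \<theta>: "0 \<le> \<theta>" "\<theta> \<le> 1 / (2 * real m)"
    and q: "q > 0" "1 / q = 1 / 2 + 1 / (2 * real m) - \<theta>"
    and B: "B \<ge> 0"
    and bd: "\<And>\<mu> r y. (\<And>i. \<mu> i \<ge> 0) \<Longrightarrow> (\<Sum>i<n. \<mu> i) = 1 \<Longrightarrow> r > 0 \<Longrightarrow>
      (\<And>i. i < n \<Longrightarrow> cmod (y i) \<le> r * \<mu> i powr \<theta>) \<Longrightarrow> cmod (hom_poly m n b y) \<le> r ^ m * B"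
  shows "bombieri_norm m n q b \<le> (1 + exp (3 + gain_const) / real m) * B"
proof -
  have q_ge: "real m / (real m + 1) \<le> q / 2"
  proof -
    have "1 / q \<le> 1 / 2 + 1 / (2 * real m)" using q(2) \<theta>(1) by linarith
    also have "\<dots> = (real m + 1) / (2 * real m)" using m by (simp add: field_simps)
    finally have "1 / q \<le> (real m + 1) / (2 * real m)" .
    then show ?thesis using q(1) m by (simp add: field_simps)
  qed
  have q_le: "q \<le> 2"
  proof -
    have "1 / q \<ge> 1 / 2" using q(2) \<theta>(2) by simp
    then show ?thesis using q(1) by (simp add: field_simps)
  qed
  have q_inv: "1 / q \<le> 1"
  proof -
    have "1 / (2 * real m) \<le> 1 / 2" using m by (simp add: field_simps)
    then show ?thesis using q(2) \<theta>(1) by simp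
  qed
  have gc: "gain_const \<ge> 0"
  proof -
    have "1 \<le> 48 * 6 ^ 6 + 4 * exp (16::real)" by (simp add: add_increasing2)
    then have "ln (48 * 6 ^ 6 + 4 * exp (16::real)) \<ge> 0" by (rule ln_ge_zero)
    then show ?thesis unfolding gain_const_def by linarith
  qed
  define f where "f \<alpha> = multinom m n \<alpha> powr (1 - q) * cmod (b \<alpha>) powr q" for \<alpha>
  \<comment> \<open>Vanishing coefficients are left out because \<open>entropy_bound\<close> takes
    logarithms of their moduli.\<close>
  define S where "S = {\<alpha>\<in>multi_indices m n. b \<alpha> \<noteq> 0 \<and> (\<forall>i<n. \<alpha> i \<noteq> m)}"
  define R where "R = (\<Sum>\<alpha>\<in>S. f \<alpha>)"
  have f0: "f \<alpha> \<ge> 0" for \<alpha> by (simp add: f_def)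
  have "R \<ge> 0" unfolding R_def by (intro sum_nonneg f0)
  have diag: "(\<Sum>i<n. cmod (b (diag_index m i)) powr q) \<le> B powr q"
  proof (rule diag_powr_sum_le[OF m \<theta>(2) q])
    fix \<mu> :: "nat \<Rightarrow> real" assume \<mu>: "\<And>i. \<mu> i \<ge> 0" "(\<Sum>i<n. \<mu> i) = 1"
    show "(\<Sum>i<n. (\<mu> i powr \<theta>) ^ m * cmod (b (diag_index m i))) \<le> B"
    proof (rule sum_diag_coeffs_le[OF m])
      fix y assume "\<And>i. i < n \<Longrightarrow> cmod (y i) \<le> \<mu> i powr \<theta>"
      then show "cmod (hom_poly m n b y) \<le> B" using bd[OF \<mu>, of 1 y] by simp
    qed simp
  qed simp
  have off_diag: "R \<le> exp (3 + gain_const) / real m * B powr q"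
  proof (cases "R = 0")
    case True
    then show ?thesis by simp
  next
    case False
    with \<open>R \<ge> 0\<close> have R: "R > 0" by simp
    define K where "K = (1 + 1 / real m) ^ m * B"
    define G where "G = ln (real m) - gain_const"
    have K: "K > 0 \<and> ln R / q + G / 2 \<le> ln K"
    proof (rule entropy_bound[OF m \<theta>(2) q, of S n b])
      show "S \<subseteq> multi_indices m n" by (auto simp: S_def)
      show "b \<alpha> \<noteq> 0" if "\<alpha> \<in> S" for \<alpha> using that by (simp add: S_def)
      show "G \<le> gain m n \<alpha>" if "\<alpha> \<in> S" for \<alpha>
        unfolding G_def using that m by (intro gain_ge) (auto simp: S_def)
      show "R = (\<Sum>\<alpha>\<in>S. multinom m n \<alpha> powr (1 - q) * cmod (b \<alpha>) powr q)"
        by (simp add: R_def f_def)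
      show "R > 0" by (fact R)
      fix \<mu> :: "nat \<Rightarrow> real" assume \<mu>: "\<And>i. \<mu> i \<ge> 0" "(\<Sum>i<n. \<mu> i) = 1"
      show "(\<Sum>i<n. sqrt (\<Sum>\<alpha>\<in>multi_indices m n. (\<Prod>j\<in>{..<n} - {i}. wt (\<alpha> j)) *
        (real (\<alpha> i) * cmod (b \<alpha>) * (\<Prod>j<n. (\<mu> j powr \<theta>) ^ \<alpha> j))\<^sup>2)) \<le> real m * K"
      proof (rule sum_sqrt_gradient_le[OF m])
        fix y assume "\<And>i. i < n \<Longrightarrow> cmod (y i) \<le> (1 + 1 / real m) * \<mu> i powr \<theta>"
        moreover have "1 + 1 / real m > 0" using m by (simp add: add_pos_nonneg)
        ultimately show "cmod (hom_poly m n b y) \<le> K"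
          unfolding K_def by (intro bd[OF \<mu>]) auto
      qed simp
    qed
    have fac: "1 + 1 / real m > 0" using m by (simp add: add_pos_nonneg)
    then have "B > 0" using K by (auto simp: K_def zero_less_mult_iff)
    have "ln K = real m * ln (1 + 1 / real m) + ln B"
      unfolding K_def using fac \<open>B > 0\<close> by (simp add: ln_mult_pos ln_realpow)
    also have "ln (1 + 1 / real m) \<le> 1 / real m"
      by (rule ln_add_one_self_le_self) simp
    then have "real m * ln (1 + 1 / real m) \<le> 1" using m by (simp add: field_simps)
    finally have lnK: "ln K \<le> 1 + ln B" by simp
    \<comment> \<open>Since \<open>q / 2\<close> is at least \<open>m / (m + 1)\<close>, the power
      \<open>m powr (q / 2)\<close> falls short of \<open>m\<close> by at most a factor e.\<close>
    have lnm: "ln (real m) - 1 \<le> q / 2 * ln (real m)"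
    proof -
      have "ln (real m) \<le> real m" using m by (intro ln_bound) simp
      then have "ln (real m) / (real m + 1) \<le> 1" by (simp add: field_simps)
      moreover have "ln (real m) - ln (real m) / (real m + 1) = real m / (real m + 1) * ln (real m)"
        by (simp add: field_simps)
      moreover have "real m / (real m + 1) * ln (real m) \<le> q / 2 * ln (real m)"
        using q_ge m by (intro mult_right_mono) auto
      ultimately show ?thesis by linarith
    qed
    have "ln R \<le> q * (1 + ln B - G / 2)"
    proof -
      have "ln R / q \<le> 1 + ln B - G / 2" using K lnK by linarith
      then show ?thesis using q(1) by (simp add: field_simps)
    qed
    also have "\<dots> = q * ln B + q * (1 + gain_const / 2) - q / 2 * ln (real m)"
      unfolding G_def by (simp add: diff_divide_distrib distrib_left right_diff_distrib)
    \<comment> \<open>The constant \<open>3 + gain_const\<close> arises from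
      \<open>q \<le> 2\<close>, which gives \<open>2 + gain_const\<close>, and from the 1 lost in
      \<open>lnm\<close>.\<close>
    also have "\<dots> \<le> q * ln B + 2 * (1 + gain_const / 2) - (ln (real m) - 1)"
      using lnm q_le gc by (intro diff_mono add_left_mono mult_right_mono) auto
    finally have "ln R \<le> q * ln B + (3 + gain_const) - ln (real m)" by simp
    then have "R \<le> exp (q * ln B + (3 + gain_const) - ln (real m))"
      using R by (metis exp_le_cancel_iff exp_ln)
    also have "\<dots> = exp (3 + gain_const) / real m * B powr q"
      using m \<open>B > 0\<close> by (simp add: exp_diff exp_add powr_def)
    finally show ?thesis .
  qed
  have split: "(\<Sum>\<alpha>\<in>multi_indices m n. f \<alpha>) = (\<Sum>i<n. cmod (b (diag_index m i)) powr q) + R"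
  proof -
    let ?D = "diag_index m ` {..<n}"
    have "(\<Sum>\<alpha>\<in>multi_indices m n. f \<alpha>) = (\<Sum>\<alpha>\<in>multi_indices m n - ?D. f \<alpha>) + (\<Sum>\<alpha>\<in>?D. f \<alpha>)"
      by (intro sum.subset_diff finite_multi_indices) (auto intro: diag_index_in)
    also have "(\<Sum>\<alpha>\<in>?D. f \<alpha>) = (\<Sum>i<n. cmod (b (diag_index m i)) powr q)"
      unfolding sum.reindex[OF inj_on_diag_index[OF m]]
      by (intro sum.cong refl) (simp add: f_def multinom_diag_index)
    also have "(\<Sum>\<alpha>\<in>multi_indices m n - ?D. f \<alpha>) = R"
      unfolding R_def
    proof (rule sum.mono_neutral_right)
      show "finite (multi_indices m n - ?D)" by (intro finite_Diff finite_multi_indices)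
      show "S \<subseteq> multi_indices m n - ?D" by (auto simp: S_def diag_index_def)
      show "\<forall>\<alpha>\<in>multi_indices m n - ?D - S. f \<alpha> = 0"
      proof
        fix \<alpha> assume \<alpha>: "\<alpha> \<in> multi_indices m n - ?D - S"
        then have "\<forall>i<n. \<alpha> i \<noteq> m" using multi_indices_eq_diag[of \<alpha> m n] by blast
        with \<alpha> have "b \<alpha> = 0" by (simp add: S_def)
        then show "f \<alpha> = 0" by (simp add: f_def)
      qed
    qed
    finally show ?thesis by (simp add: add.commute)
  qed
  define c where "c = 1 + exp (3 + gain_const) / real m"
  have c: "c \<ge> 1" by (simp add: c_def)
  have "(\<Sum>\<alpha>\<in>multi_indices m n. f \<alpha>) \<le> c * B powr q"
    unfolding split c_def using diag off_diag by (simp add: distrib_right)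
  then have "(\<Sum>\<alpha>\<in>multi_indices m n. f \<alpha>) powr (1 / q) \<le> (c * B powr q) powr (1 / q)"
    using q(1) by (intro powr_mono2 sum_nonneg f0) auto
  also have "\<dots> = c powr (1 / q) * B"
    using c B q(1) by (simp add: powr_mult powr_powr)
  \<comment> \<open>As \<open>q\<close> is at least 1, the outer root does not enlarge
    \<open>c\<close>.\<close>
  also have "\<dots> \<le> c powr 1 * B"
    using c B q_inv by (intro mult_right_mono powr_mono) auto
  finally show ?thesis
    using c by (simp add: bombieri_norm_def f_def multinom_def c_def)
qed

text \<open>In reciprocals, both cases of \<open>q_exponent\<close> become a single relation that is
  linear in \<open>1 / p\<close>.\<close>

lemma q_exponent_inverse:
  assumes m: "m \<ge> 1" and p: "ereal (2 * real m) \<le> p"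
  shows "0 \<le> inv_exponent p" "inv_exponent p \<le> 1 / (2 * real m)" "q_exponent m p > 0"
    "1 / q_exponent m p = 1 / 2 + 1 / (2 * real m) - inv_exponent p"
proof -
  have "0 \<le> inv_exponent p \<and> inv_exponent p \<le> 1 / (2 * real m) \<and> q_exponent m p > 0 \<and>
    1 / q_exponent m p = 1 / 2 + 1 / (2 * real m) - inv_exponent p"
  proof (cases "p = \<infinity>")
    case True
    then show ?thesis using m by (simp add: inv_exponent_def q_exponent_def field_simps)
  next
    case False
    with p obtain r where r: "p = ereal r" "2 * real m \<le> r"
      by (cases p) auto
    have r0: "r > 0" using r m by linarith
    have "real m * r > 0" using r0 m by simp
    then have den: "real m * r + r - 2 * real m > 0" using r by linarith
    have "inv_exponent p \<le> 1 / (2 * real m)"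
      using r m r0 by (simp add: inv_exponent_def frac_le)
    moreover have "q_exponent m p = 2 * real m * r / (real m * r + r - 2 * real m)"
      using r by (simp add: q_exponent_def)
    then have "1 / q_exponent m p = (real m * r + r - 2 * real m) / (2 * real m * r)" "q_exponent m p > 0"
      using den m r0 by auto
    moreover have "(real m * r + r - 2 * real m) / (2 * real m * r) = 1 / 2 + 1 / (2 * real m) - 1 / r"
      using m r0 by (simp add: field_simps)
    ultimately show ?thesis using r r0 by (simp add: inv_exponent_def)
  qed
  then show "0 \<le> inv_exponent p" "inv_exponent p \<le> 1 / (2 * real m)" "q_exponent m p > 0"
    "1 / q_exponent m p = 1 / 2 + 1 / (2 * real m) - inv_exponent p" by auto
qed

theorem theorem2:
  "\<exists>C::real. C > 0 \<and>
     (\<forall>m n :: nat. \<forall>p :: ereal. \<forall>b :: (nat \<Rightarrow> nat) \<Rightarrow> complex.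
        m \<ge> 1 \<longrightarrow> n \<ge> 1 \<longrightarrow> ereal (2 * real m) \<le> p \<longrightarrow>
        bombieri_norm m n (q_exponent m p) b
          \<le> (1 + C / real m) * lp_sup_norm n p (hom_poly m n b))"
proof (intro exI[of _ "exp (3 + gain_const)"] conjI allI impI)
  fix m n :: nat and p :: ereal and b :: "(nat \<Rightarrow> nat) \<Rightarrow> complex"
  assume m: "m \<ge> 1" and n: "n \<ge> 1" and p: "ereal (2 * real m) \<le> p"
  define \<theta> where "\<theta> = inv_exponent p"
  note q = q_exponent_inverse[OF m p]
  have p1: "1 \<le> p"
  proof -
    have "(1::ereal) \<le> ereal (2 * real m)" using m by (simp add: one_ereal_def)
    then show ?thesis using p by (rule order_trans)
  qed
  have bd: "cmod (hom_poly m n b y) \<le> r ^ m * lp_sup_norm n p (hom_poly m n b)"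
    if "\<And>i. \<mu> i \<ge> 0" "(\<Sum>i<n. \<mu> i) = 1" "r > 0"
      "\<And>i. i < n \<Longrightarrow> cmod (y i) \<le> r * \<mu> i powr inv_exponent p" for \<mu> r y
    using that
    by (intro cmod_hom_poly_le[OF p1 n lp_norm_powr_inv_exponent_le[OF p1 n, of \<mu>]]) auto
  \<comment> \<open>The supremum is nonnegative because it dominates the value at the origin. Any
    probability vector may serve in \<open>bd\<close>; the point mass at index 0 is one because
    \<open>n \<ge> 1\<close>.\<close>
  have "0 \<le> cmod (hom_poly m n b (\<lambda>_. 0))" by simp
  also have "\<dots> \<le> 1 ^ m * lp_sup_norm n p (hom_poly m n b)"
    using n by (intro bd[of "\<lambda>i. if i = 0 then 1 else 0"]) auto
  finally have "0 \<le> lp_sup_norm n p (hom_poly m n b)" by simp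
  then show "bombieri_norm m n (q_exponent m p) b
      \<le> (1 + exp (3 + gain_const) / real m) * lp_sup_norm n p (hom_poly m n b)"
    using bd by (intro bombieri_norm_le[OF m q(1,2,3,4)]) auto
qed simp

end
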